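(* For every integer $L \ge 1$, $$N_{Z,{\rm tri},{\rm PF},L}=\frac{1}{L}\left[ C_L + \sum_{d\mid L,\ 1 \le d < L} \phi(L/d)\binom{2d}{d} \right],$$ where $C_L = \frac{1}{L+1}\binom{2L}{L}$ is the $L$-th Catalan number, the sum runs over the positive divisors $d$ of $L$ with $d<L$, and $\phi$ is the Euler function, $\phi(n)$ being the number of positive integers not exceeding $n$ and relatively prime to $n$.
   Context: A set partition of $\{1,2,\ldots,L\}$ is non-crossing if there are no $a<b<c<d$ such that $a,c$ belong to one block and $b,d$ belong to a different block. Regard $1,\ldots,L$ as the vertices, in cyclic order, of a circuit with $L$ vertices. The rotation $i \mapsto i+1 \pmod L$ acts on the set of non-crossing partitions of $\{1,\ldots,L\}$. $N_{Z,{\rm tri},{\rm PF},L}$ is the number of equivalence classes (orbits) of non-crossing partitions of $\{1,\ldots,L\}$ under the group generated by this rotation. (This is the dimension of the translation-invariant transfer matrix, in the Fortuin-Kasteleyn representation, of the Potts model on a triangular-lattice strip of width $L$ with periodic transverse and free longitudinal boundary conditions.) *)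

theory Defs
  imports "HOL-Algebra.Group_Action" "HOL-Algebra.Elementary_Groups" "HOL-Number_Theory.Totient"
    "HOL-Library.Disjoint_Sets"
begin

definition noncrossing_partitions :: "nat \<Rightarrow> nat set set set" where
  "noncrossing_partitions L =
     {P. partition_on {1..L} P \<and>
         \<not> (\<exists>a b c d. \<exists>A\<in>P. \<exists>B\<in>P. A \<noteq> B \<and> a < b \<and> b < c \<and> c < d \<and>
              a \<in> A \<and> c \<in> A \<and> b \<in> B \<and> d \<in> B)}"

text \<open>
  The map $i \mapsto i + 1$ on residues modulo $L$, with representatives $1, \ldots, L$
  (so that $L \mapsto 1$); it is restricted to \<open>{1..L}\<close> because the elements of
  \<^const>\<open>BijGroup\<close> are extensional functions.
\<close>
definition rotation :: "nat \<Rightarrow> nat \<Rightarrow> nat" where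
  "rotation L = (\<lambda>i\<in>{1..L}. i mod L + 1)"

definition rotation_group :: "nat \<Rightarrow> (nat \<Rightarrow> nat) monoid" where
  "rotation_group L = subgroup_generated (BijGroup {1..L}) {rotation L}"

definition partition_action :: "nat \<Rightarrow> (nat \<Rightarrow> nat) \<Rightarrow> nat set set \<Rightarrow> nat set set" where
  "partition_action L g = (\<lambda>P\<in>noncrossing_partitions L. (\<lambda>A. g ` A) ` P)"

definition N_Z_tri_PF :: "nat \<Rightarrow> nat" where
  "N_Z_tri_PF L =
     card (orbits (rotation_group L) (noncrossing_partitions L) (partition_action L))"

definition catalan :: "nat \<Rightarrow> real" where
  "catalan L = 1 / real (L + 1) * real ((2 * L) choose L)"


text \<open>
  \<^const>\<open>subgroup_generated\<close> discards generators outside the carrier, and \<^const>\<open>orbits\<close>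
  does not itself require an action; the following facts show that neither matters here.
\<close>

lemma rotation_in_Bij: "rotation L \<in> Bij {1..L}"
proof -
  have maps: "rotation L ` {1..L} \<subseteq> {1..L}"
    by (auto simp: rotation_def Suc_le_eq)
  have "inj_on (rotation L) {1..L}"
  proof (rule inj_onI)
    fix i j assume "i \<in> {1..L}" "j \<in> {1..L}" "rotation L i = rotation L j"
    thus "i = j"
      by (cases "i = L"; cases "j = L") (auto simp: rotation_def)
  qed
  hence "bij_betw (rotation L) {1..L} {1..L}"
    using maps by (metis bij_betw_def endo_inj_surj finite_atLeastAtMost)
  thus ?thesis
    by (auto simp: Bij_def rotation_def)
qed

lemma finite_noncrossing_partitions: "finite (noncrossing_partitions L)"
  by (rule finite_subset[OF _ finitely_many_partition_on[of "{1..L}"]])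
     (auto simp: noncrossing_partitions_def)

lemma block_subset: "P \<in> noncrossing_partitions L \<Longrightarrow> A \<in> P \<Longrightarrow> A \<subseteq> {1..L}"
  by (auto simp: noncrossing_partitions_def partition_on_def)

lemma partition_on_image_Bij:
  assumes "g \<in> Bij S" "partition_on S P"
  shows "partition_on S ((\<lambda>A. g ` A) ` P)"
proof -
  have g: "bij_betw g S S" using assms(1) by (auto simp: Bij_def)
  have P: "\<Union>P = S" "disjoint P" "{} \<notin> P" using assms(2) by (auto simp: partition_on_def)
  have "\<Union>((\<lambda>A. g ` A) ` P) = g ` \<Union>P" by blast
  moreover have "disjoint ((\<lambda>A. g ` A) ` P)"
  proof (rule disjointI)
    fix X Y assume "X \<in> (\<lambda>A. g ` A) ` P" "Y \<in> (\<lambda>A. g ` A) ` P" "X \<noteq> Y"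
    then obtain A B where AB: "A \<in> P" "B \<in> P" "X = g ` A" "Y = g ` B" "A \<noteq> B" by blast
    have "A \<inter> B = {}" using AB P(2) by (auto simp: disjoint_def)
    moreover have "A \<subseteq> S" "B \<subseteq> S" using AB P(1) by auto
    ultimately show "X \<inter> Y = {}"
      using g AB inj_on_image_Int[of g S A B] by (auto simp: bij_betw_def)
  qed
  ultimately show ?thesis
    using P g by (auto simp: partition_on_def bij_betw_def)
qed

lemma rotation_noncrossing:
  assumes "P \<in> noncrossing_partitions L"
  shows "(\<lambda>A. rotation L ` A) ` P \<in> noncrossing_partitions L"
proof -
  have part: "partition_on {1..L} P" using assms by (simp add: noncrossing_partitions_def)
  have nc: False if "A \<in> P" "B \<in> P" "A \<noteq> B" "a < b" "b < c" "c < d"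
      "a \<in> A" "c \<in> A" "b \<in> B" "d \<in> B" for A B a b c d
    using assms that unfolding noncrossing_partitions_def by blast
  have pre: "\<exists>i\<in>A. i \<le> L \<and> (x = i + 1 \<and> i < L \<or> x = 1 \<and> i = L)"
    if "x \<in> rotation L ` A" "A \<in> P" for x A
  proof -
    from that obtain i where i: "i \<in> A" "x = rotation L i" by blast
    have "i \<in> {1..L}" using block_subset[OF assms that(2)] i by blast
    thus ?thesis using i by (cases "i = L") (auto simp: rotation_def)
  qed
  have False if *: "A \<in> P" "B \<in> P" "rotation L ` A \<noteq> rotation L ` B"
      "a < b" "b < c" "c < d"
      "a \<in> rotation L ` A" "c \<in> rotation L ` A" "b \<in> rotation L ` B" "d \<in> rotation L ` B"
    for A B a b c d
  proof -
    have ne: "A \<noteq> B" using * by auto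
    obtain i where i: "i \<in> A" "i \<le> L" "a = i + 1 \<and> i < L \<or> a = 1 \<and> i = L"
      using pre[OF *(7) *(1)] by blast
    have "a \<ge> 1" using i by auto
    obtain k where k: "k \<in> A" "k < L" "c = k + 1"
      using pre[OF *(8) *(1)] \<open>a \<ge> 1\<close> *(4-6) by fastforce
    obtain j where j: "j \<in> B" "j < L" "b = j + 1"
      using pre[OF *(9) *(2)] \<open>a \<ge> 1\<close> *(4-6) by fastforce
    obtain l where l: "l \<in> B" "l < L" "d = l + 1"
      using pre[OF *(10) *(2)] \<open>a \<ge> 1\<close> *(4-6) by fastforce
    show False
    proof (cases "i = L")
      case True
      show False
        using nc[of B A j k l i] * ne i j k l True by auto
    next
      case False
      show False
        using nc[of A B i j k l] * ne i j k l False by auto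
    qed
  qed
  hence "\<not> (\<exists>a b c d. \<exists>A\<in>(\<lambda>A. rotation L ` A) ` P. \<exists>B\<in>(\<lambda>A. rotation L ` A) ` P.
       A \<noteq> B \<and> a < b \<and> b < c \<and> c < d \<and> a \<in> A \<and> c \<in> A \<and> b \<in> B \<and> d \<in> B)"
    by blast
  thus ?thesis
    using partition_on_image_Bij[OF rotation_in_Bij part]
    by (simp add: noncrossing_partitions_def)
qed

lemma image_blocks_eqD:
  assumes "inj_on g S" "\<Union>P \<subseteq> S" "\<Union>Q \<subseteq> S" "(\<lambda>A. g ` A) ` P = (\<lambda>A. g ` A) ` Q"
  shows "P = Q"
proof -
  have "inj_on (\<lambda>A. g ` A) (Pow S)" using assms(1) by (rule inj_on_image_Pow)
  moreover have "P \<subseteq> Pow S" "Q \<subseteq> Pow S" using assms by auto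
  ultimately show ?thesis using assms(4) inj_on_image_eq_iff by metis
qed

lemma partition_action_bij:
  assumes g: "g \<in> Bij {1..L}"
    and maps: "\<And>P. P \<in> noncrossing_partitions L \<Longrightarrow> (\<lambda>A. g ` A) ` P \<in> noncrossing_partitions L"
  shows "partition_action L g \<in> Bij (noncrossing_partitions L)"
proof -
  let ?E = "noncrossing_partitions L"
  have "inj_on (partition_action L g) ?E"
  proof (rule inj_onI)
    fix P Q assume PQ: "P \<in> ?E" "Q \<in> ?E" "partition_action L g P = partition_action L g Q"
    show "P = Q"
    proof (rule image_blocks_eqD[of g "{1..L}"])
      show "\<Union>P \<subseteq> {1..L}" "\<Union>Q \<subseteq> {1..L}"
        using block_subset[OF PQ(1)] block_subset[OF PQ(2)] by blast+
    qed (use g PQ in \<open>auto simp: Bij_def bij_betw_def partition_action_def\<close>)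
  qed
  moreover have "partition_action L g ` ?E \<subseteq> ?E"
    using maps by (auto simp: partition_action_def)
  ultimately have "bij_betw (partition_action L g) ?E ?E"
    by (metis bij_betw_def endo_inj_surj finite_noncrossing_partitions)
  thus ?thesis by (auto simp: Bij_def partition_action_def)
qed

lemma rotation_group_preserves:
  assumes "g \<in> carrier (rotation_group L)"
  shows "g \<in> Bij {1..L}"
    and "P \<in> noncrossing_partitions L \<Longrightarrow> (\<lambda>A. g ` A) ` P \<in> noncrossing_partitions L"
proof -
  interpret B: group "BijGroup {1..L}" by (rule group_BijGroup)
  have carr: "carrier (BijGroup {1..L}) = Bij {1..L}" by (simp add: BijGroup_def)
  have "g \<in> generate (BijGroup {1..L}) {rotation L}"
    using assms rotation_in_Bij[of L] carr
    by (simp add: rotation_group_def carrier_subgroup_generated del: One_nat_def)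
  hence "g \<in> Bij {1..L} \<and> (\<forall>P\<in>noncrossing_partitions L.
           (\<lambda>A. g ` A) ` P \<in> noncrossing_partitions L)"
  proof (induction rule: generate.induct)
    case one
    have "(\<lambda>A. (\<lambda>x\<in>{1..L}. x) ` A) ` P = P" if "P \<in> noncrossing_partitions L" for P
    proof -
      have "(\<lambda>x\<in>{1..L}. x) ` A = A" if "A \<in> P" for A
        using block_subset[OF \<open>P \<in> _\<close> that] by (force simp: image_def)
      thus ?thesis by simp
    qed
    moreover have "\<one>\<^bsub>BijGroup {1..L}\<^esub> = (\<lambda>x\<in>{1..L}. x)"
      by (simp add: BijGroup_def)
    ultimately show ?case using id_Bij[of "{1..L}"] by metis
  next
    case (incl h)
    thus ?case using rotation_in_Bij rotation_noncrossing by auto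
  next
    case (inv h)
    hence h: "h = rotation L" by simp
    let ?k = "\<lambda>x\<in>{1..L}. inv_into {1..L} (rotation L) x"
    have k: "inv\<^bsub>BijGroup {1..L}\<^esub> h = ?k"
      unfolding h by (rule inv_BijGroup[OF rotation_in_Bij])
    have r: "inj_on (rotation L) {1..L}" "rotation L ` {1..L} = {1..L}"
      using rotation_in_Bij[of L] by (auto simp: Bij_def bij_betw_def)
    have "(\<lambda>A. ?k ` A) ` P \<in> noncrossing_partitions L"
      if P: "P \<in> noncrossing_partitions L" for P
    proof -
      have "partition_action L (rotation L) \<in> Bij (noncrossing_partitions L)"
        using partition_action_bij[OF rotation_in_Bij] rotation_noncrossing by blast
      hence "P \<in> partition_action L (rotation L) ` noncrossing_partitions L"
        using P by (simp add: Bij_def bij_betw_def)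
      then obtain Q where Q: "Q \<in> noncrossing_partitions L" "partition_action L (rotation L) Q = P"
        by blast
      have "?k ` (rotation L ` A) = A" if "A \<in> Q" for A
      proof -
        have "A \<subseteq> {1..L}" using block_subset[OF Q(1) that] .
        have k: "?k (rotation L x) = x" if "x \<in> A" for x
        proof -
          have "x \<in> {1..L}" using \<open>A \<subseteq> _\<close> that by blast
          moreover from this have "rotation L x \<in> {1..L}" using r(2) by blast
          ultimately show ?thesis using inv_into_f_f[OF r(1)] by (simp only: restrict_apply' )
        qed
        have "?k ` (rotation L ` A) = (\<lambda>x. ?k (rotation L x)) ` A" by (rule image_image)
        also have "\<dots> = (\<lambda>x. x) ` A" by (rule image_cong) (use k in auto)
        finally show ?thesis by simp
      qed
      hence "(\<lambda>A. ?k ` (rotation L ` A)) ` Q = (\<lambda>A. A) ` Q"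
        by (intro image_cong) auto
      moreover have "P = (\<lambda>A. rotation L ` A) ` Q"
        using Q by (simp add: partition_action_def)
      ultimately have "(\<lambda>A. ?k ` A) ` P = Q"
        by (simp only: image_image[of _ "\<lambda>A. rotation L ` A"] image_ident)
      thus ?thesis using Q by simp
    qed
    thus ?case unfolding k using restrict_inv_into_Bij[OF rotation_in_Bij] by blast
  next
    case (eng h1 h2)
    have "(\<lambda>A. compose {1..L} h1 h2 ` A) ` P = (\<lambda>A. h1 ` A) ` ((\<lambda>A. h2 ` A) ` P)"
      if "P \<in> noncrossing_partitions L" for P
    proof -
      have "compose {1..L} h1 h2 ` A = h1 ` (h2 ` A)" if "A \<in> P" for A
        using block_subset[OF \<open>P \<in> _\<close> that] by (force simp: compose_def image_image)
      thus ?thesis by (simp add: image_image)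
    qed
    thus ?case using eng by (auto simp: BijGroup_def compose_Bij)
  qed
  thus "g \<in> Bij {1..L}"
    and "P \<in> noncrossing_partitions L \<Longrightarrow> (\<lambda>A. g ` A) ` P \<in> noncrossing_partitions L"
    by auto
qed

lemma rotation_in_rotation_group: "rotation L \<in> carrier (rotation_group L)"
  using rotation_in_Bij[of L]
  by (auto simp: rotation_group_def carrier_subgroup_generated BijGroup_def intro: generate.incl)

lemma group_action_rotation_group:
  "group_action (rotation_group L) (noncrossing_partitions L) (partition_action L)"
proof -
  let ?E = "noncrossing_partitions L"
  interpret B: group "BijGroup {1..L}" by (rule group_BijGroup)
  have G: "group (rotation_group L)"
    unfolding rotation_group_def by (rule B.group_subgroup_generated)
  have bij: "partition_action L g \<in> Bij ?E" if "g \<in> carrier (rotation_group L)" for g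
    using partition_action_bij rotation_group_preserves[OF that] by blast
  have mult: "partition_action L (g \<otimes>\<^bsub>rotation_group L\<^esub> h) =
      partition_action L g \<otimes>\<^bsub>BijGroup ?E\<^esub> partition_action L h"
    if g: "g \<in> carrier (rotation_group L)" and h: "h \<in> carrier (rotation_group L)" for g h
  proof -
    have gh: "g \<otimes>\<^bsub>rotation_group L\<^esub> h = compose {1..L} g h"
      using rotation_group_preserves(1)[OF g] rotation_group_preserves(1)[OF h]
      by (simp add: rotation_group_def BijGroup_def subgroup_generated_def)
    have "(\<lambda>A. compose {1..L} g h ` A) ` P = (\<lambda>A. g ` A) ` ((\<lambda>A. h ` A) ` P)"
      if "P \<in> ?E" for P
    proof -
      have "compose {1..L} g h ` A = g ` (h ` A)" if "A \<in> P" for A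
        using block_subset[OF \<open>P \<in> _\<close> that] by (force simp: compose_def image_image)
      thus ?thesis by (simp add: image_image)
    qed
    hence "partition_action L (compose {1..L} g h) =
        compose ?E (partition_action L g) (partition_action L h)"
      using rotation_group_preserves(2)[OF h]
      by (auto simp: partition_action_def compose_def restrict_def fun_eq_iff)
    thus ?thesis using gh bij[OF g] bij[OF h] by (simp add: BijGroup_def)
  qed
  show ?thesis
    unfolding group_action_def group_hom_def group_hom_axioms_def hom_def
    using G group_BijGroup bij mult by (auto simp: BijGroup_def)
qed

end

theory Submission
  imports Defs
begin

text \<open>
  By Burnside's lemma the number of orbits is the average over \<open>k\<close> of the number of noncrossing
  partitions fixed by the \<open>k\<close>-th rotation, which depends only on \<open>d = gcd k L\<close>. If \<open>d < L\<close>,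
  a partition fixed by the rotation by \<open>d\<close> unrolls uniquely to a \<open>d\<close>-periodic noncrossing
  equivalence relation on the integers: a block invariant under that rotation becomes an infinite
  class, and all other blocks are too short to wind around the circle. A \<open>d\<close>-periodic relation
  is in turn encoded by a walk on the integers with steps \<open>\<plusminus>1\<close> and period \<open>2 * d\<close>: the
  two steps around the point \<open>i\<close> record whether \<open>i\<close> has a smaller and a larger companion in its
  class, and \<open>i\<close> and \<open>j\<close> are related iff the walk is at the same height at \<open>i\<close> and \<open>j\<close> and
  does not go below it in between. There are \<open>(2 * d) choose d\<close> such walks. For \<open>d = L\<close> one cuts
  the circle instead of unrolling it, which singles out the nonnegative walks, that is,
  the Dyck paths.
\<close>

section \<open>Closed lattice walks and noncrossing relations on the integers\<close>

text \<open>Cutting the circle destroys the rotational symmetry, so partitions fixed by a rotation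
  are hard to count on {1..L} itself; on the integers the symmetry is plain periodicity and there is
  no seam. A proper divisor d of L satisfies 2 * d \<le> L, so that short chords and their
  translates by d fit into one turn, where the noncrossing condition can be applied to them. For d =
  L this breaks down: for L = 1 the identity and the full relation are both periodic and
  noncrossing, in agreement with 2 choose 1, but they wrap to the same partition. The encoding walks
  close up because within one period as many points have a larger companion as have a smaller one.
  The minimum of a walk shows whether there is an infinite class: if it is odd, the points at
  minimal height form one; if it is even, the relation splits at every time of minimal
  height.\<close>

definition walks :: "nat \<Rightarrow> (int \<Rightarrow> int) set" where
  "walks d = {h. h 0 = 0 \<and> (\<forall>t. \<bar>h (t + 1) - h t\<bar> = 1) \<and> (\<forall>t. h (t + 2 * int d) = h t)}"

definition noncrossing :: "(int \<Rightarrow> int \<Rightarrow> bool) \<Rightarrow> bool" where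
  "noncrossing R \<longleftrightarrow> (\<forall>a b c e. a < b \<and> b < c \<and> c < e \<and> R a c \<and> R b e \<longrightarrow> R a b)"

definition periodic_ncrel :: "nat \<Rightarrow> (int \<Rightarrow> int \<Rightarrow> bool) set" where
  "periodic_ncrel d =
     {R. equivp R \<and> noncrossing R \<and> (\<forall>i j. R (i + int d) (j + int d) = R i j)}"

text \<open>The point \<open>i\<close> sits at time \<open>2 * i - 1\<close> of the walk, which is why heights at points are odd.\<close>
definition walk_rel :: "(int \<Rightarrow> int) \<Rightarrow> int \<Rightarrow> int \<Rightarrow> bool" where
  "walk_rel h i j \<longleftrightarrow> h (2 * i - 1) = h (2 * j - 1) \<and>
     (\<forall>t. 2 * min i j - 1 \<le> t \<and> t \<le> 2 * max i j - 1 \<longrightarrow> h (2 * i - 1) \<le> h t)"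

text \<open>Time \<open>2 * i - 2\<close> is just before the point \<open>i\<close> and
  \<open>2 * i\<close> just after it. A point alone in its class is thus a peak of the walk, a point
  with companions on both sides a valley; the first point of a class lies on a rise and the last one
  on a descent.\<close>

definition compatible :: "(int \<Rightarrow> int \<Rightarrow> bool) \<Rightarrow> (int \<Rightarrow> int) \<Rightarrow> bool" where
  "compatible R h \<longleftrightarrow> (\<forall>t. \<bar>h (t + 1) - h t\<bar> = 1) \<and>
     (\<forall>i. (\<exists>j>i. R i j) \<longleftrightarrow> h (2 * i) = h (2 * i - 1) + 1) \<and>
     (\<forall>i. (\<exists>j<i. R j i) \<longleftrightarrow> h (2 * i - 2) = h (2 * i - 1) + 1)"

definition consecutive :: "(int \<Rightarrow> int \<Rightarrow> bool) \<Rightarrow> int \<Rightarrow> int \<Rightarrow> bool" where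
  "consecutive R i j \<longleftrightarrow> i < j \<and> R i j \<and> (\<forall>k. i < k \<and> k < j \<longrightarrow> \<not> R i k)"

section \<open>Unit-step walks: parity and hitting times\<close>

lemma walk_parity:
  fixes h :: "int \<Rightarrow> int"
  assumes "h 0 = 0" "\<And>t. \<bar>h (t + 1) - h t\<bar> = 1"
  shows "even (h t) = even t"
proof (induction t rule: int_induct[of _ 0])
  case base
  show ?case using assms(1) by simp
next
  case (step1 i)
  have "odd (h (i + 1) - h i)" using assms(2)[of i] by presburger
  thus ?case using step1 by simp
next
  case (step2 i)
  have "odd (h i - h (i - 1))" using assms(2)[of "i - 1"] by simp presburger
  thus ?case using step2 by simp
qed

text \<open>Discrete intermediate value theorem: unit steps cannot jump over the level
  \<open>l\<close>, so the first time at or below it is exactly at it.\<close>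

lemma first_hit:
  fixes h :: "int \<Rightarrow> int"
  assumes step: "\<And>t. \<bar>h (t + 1) - h t\<bar> = 1" and "l < h a" "a < b" "h b \<le> l"
  obtains t where "a < t" "h t = l" "\<And>s. a \<le> s \<Longrightarrow> s < t \<Longrightarrow> l < h s"
proof -
  define n where "n = (LEAST n::nat. h (a + int n) \<le> l)"
  have "h (a + int (nat (b - a))) \<le> l" using assms by simp
  hence n: "h (a + int n) \<le> l" unfolding n_def by (rule LeastI)
  have below: "l < h s" if "a \<le> s" "s < a + int n" for s
  proof -
    have "nat (s - a) < n" using that by linarith
    hence "\<not> h (a + int (nat (s - a))) \<le> l" unfolding n_def by (rule not_less_Least)
    thus ?thesis using that by simp
  qed
  have "n \<noteq> 0" using n assms(2) by (cases n) auto
  have "h (a + int n) = l"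
    using step[of "a + int n - 1"] below[of "a + int n - 1"] n \<open>n \<noteq> 0\<close> by simp
  thus ?thesis using that[of "a + int n"] below \<open>n \<noteq> 0\<close> by simp
qed

lemma last_hit:
  fixes h :: "int \<Rightarrow> int"
  assumes step: "\<And>t. \<bar>h (t + 1) - h t\<bar> = 1" and "l < h a" "b < a" "h b \<le> l"
  obtains t where "t < a" "h t = l" "\<And>s. t < s \<Longrightarrow> s \<le> a \<Longrightarrow> l < h s"
proof -
  define g where "g t = h (- t)" for t
  have "\<bar>g (t + 1) - g t\<bar> = 1" for t
    using step[of "- t - 1"] by (simp add: g_def abs_minus_commute)
  then obtain t where t: "- a < t" "g t = l" "\<And>s. - a \<le> s \<Longrightarrow> s < t \<Longrightarrow> l < g s"
    using first_hit[of g l "- a" "- b"] assms unfolding g_def by auto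
  show ?thesis
    using that[of "- t"] t(1,2) t(3)[of "- s" for s] unfolding g_def
    by (metis add.inverse_inverse minus_le_iff minus_less_iff neg_le_iff_le)
qed

section \<open>The noncrossing relation of a walk\<close>

lemma walk_relD:
  assumes "walk_rel h i j"
  shows "h (2 * i - 1) = h (2 * j - 1)"
    and "i \<le> j \<Longrightarrow> 2 * i - 1 \<le> t \<Longrightarrow> t \<le> 2 * j - 1 \<Longrightarrow> h (2 * i - 1) \<le> h t"
proof -
  show "h (2 * i - 1) = h (2 * j - 1)" using assms by (simp add: walk_rel_def)
  show "h (2 * i - 1) \<le> h t" if "i \<le> j" "2 * i - 1 \<le> t" "t \<le> 2 * j - 1"
  proof -
    have m: "min i j = i" "max i j = j" using that by auto
    show ?thesis using assms that unfolding walk_rel_def m by blast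
  qed
qed

lemma walk_relI:
  assumes "i \<le> j" "h (2 * i - 1) = h (2 * j - 1)"
    and "\<And>t. 2 * i - 1 \<le> t \<Longrightarrow> t \<le> 2 * j - 1 \<Longrightarrow> h (2 * i - 1) \<le> h t"
  shows "walk_rel h i j"
proof -
  have m: "min i j = i" "max i j = j" using assms(1) by auto
  show ?thesis using assms unfolding walk_rel_def m by blast
qed

lemma equivp_walk_rel: "equivp (walk_rel h)"
proof (rule equivpI)
  show "reflp (walk_rel h)"
  proof (rule reflpI)
    fix i
    have "t = 2 * i - 1" if "2 * i - 1 \<le> t" "t \<le> 2 * i - 1" for t :: int
      using that by simp
    thus "walk_rel h i i" by (intro walk_relI) auto
  qed
  show "symp (walk_rel h)" unfolding symp_def walk_rel_def
    by (metis max.commute min.commute)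
  show "transp (walk_rel h)"
  proof (rule transpI)
    fix i j k assume ij: "walk_rel h i j" and jk: "walk_rel h j k"
    have "h (2 * i - 1) \<le> h t" if "2 * min i k - 1 \<le> t" "t \<le> 2 * max i k - 1" for t
    proof -
      have "(2 * min i j - 1 \<le> t \<and> t \<le> 2 * max i j - 1) \<or>
            (2 * min j k - 1 \<le> t \<and> t \<le> 2 * max j k - 1)"
        using that by (auto simp: min_def max_def split: if_splits)
      thus ?thesis using ij jk unfolding walk_rel_def by metis
    qed
    thus "walk_rel h i k" using ij jk by (simp add: walk_rel_def)
  qed
qed

text \<open>Since \<open>b\<close> lies between \<open>a\<close> and \<open>c\<close>, the walk is
  at \<open>b\<close> at least as high as at \<open>a\<close>; since \<open>c\<close> lies between
  \<open>b\<close> and \<open>e\<close>, it is at \<open>c\<close>, hence at \<open>a\<close>, at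
  least as high as at \<open>b\<close>.\<close>

lemma noncrossing_walk_rel: "noncrossing (walk_rel h)"
  unfolding noncrossing_def
proof (intro allI impI)
  fix a b c e
  assume *: "a < b \<and> b < c \<and> c < e \<and> walk_rel h a c \<and> walk_rel h b e"
  hence ac: "h (2 * a - 1) = h (2 * c - 1)"
      "\<And>t. 2 * a - 1 \<le> t \<Longrightarrow> t \<le> 2 * c - 1 \<Longrightarrow> h (2 * a - 1) \<le> h t"
    and be: "\<And>t. 2 * b - 1 \<le> t \<Longrightarrow> t \<le> 2 * e - 1 \<Longrightarrow> h (2 * b - 1) \<le> h t"
    by (auto simp: walk_rel_def min_def max_def)
  have "h (2 * a - 1) = h (2 * b - 1)"
    using ac(1) ac(2)[of "2 * b - 1"] be[of "2 * c - 1"] * by simp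
  thus "walk_rel h a b" using ac(2) * by (auto simp: walk_rel_def min_def max_def)
qed

lemma walk_rel_shift:
  assumes "\<And>t. h (t + 2 * int d) = h t"
  shows "walk_rel h (i + int d) (j + int d) = walk_rel h i j"
proof -
  have m: "min (i + int d) (j + int d) = min i j + int d"
    "max (i + int d) (j + int d) = max i j + int d" by auto
  have o: "h (2 * (i + int d) - 1) = h (2 * i - 1)" for i
    using assms[of "2 * i - 1"] by (simp add: algebra_simps)
  have "(\<forall>t. 2 * (min i j + int d) - 1 \<le> t \<and> t \<le> 2 * (max i j + int d) - 1 \<longrightarrow> x \<le> h t) \<longleftrightarrow>
     (\<forall>t. 2 * min i j - 1 \<le> t \<and> t \<le> 2 * max i j - 1 \<longrightarrow> x \<le> h t)" (is "?A \<longleftrightarrow> ?B") for x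
  proof
    assume ?A
    show ?B
    proof (intro allI impI)
      fix t assume "2 * min i j - 1 \<le> t \<and> t \<le> 2 * max i j - 1"
      hence "x \<le> h (t + 2 * int d)" using \<open>?A\<close> by simp
      thus "x \<le> h t" using assms by simp
    qed
  next
    assume ?B
    show ?A
    proof (intro allI impI)
      fix t assume "2 * (min i j + int d) - 1 \<le> t \<and> t \<le> 2 * (max i j + int d) - 1"
      hence "x \<le> h (t - 2 * int d)" using \<open>?B\<close> by simp
      thus "x \<le> h t" using assms[of "t - 2 * int d"] by simp
    qed
  qed
  thus ?thesis unfolding walk_rel_def m o by simp
qed

lemma walk_rel_in_periodic_ncrel: "h \<in> walks d \<Longrightarrow> walk_rel h \<in> periodic_ncrel d"
  using equivp_walk_rel noncrossing_walk_rel walk_rel_shift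
  by (auto simp: periodic_ncrel_def walks_def)

text \<open>A down step out of \<open>i\<close> leaves the walk below its height at
  \<open>i\<close>, so no larger companion exists. After an up step periodicity forces a return to
  that height; the first return has the parity of a point, and that point is a companion. The left
  side is symmetric.\<close>

lemma compatible_walk_rel:
  assumes h: "h \<in> walks d" and "d \<ge> 1"
  shows "compatible (walk_rel h) h"
proof -
  have step: "\<And>t. \<bar>h (t + 1) - h t\<bar> = 1" and per: "\<And>t. h (t + 2 * int d) = h t"
    using h by (auto simp: walks_def)
  have par: "even (h t) = even t" for t
    using walk_parity[of h] h by (auto simp: walks_def)
  have up: "(\<exists>j>i. walk_rel h i j) \<longleftrightarrow> h (2 * i) = h (2 * i - 1) + 1" for i
  proof
    assume "\<exists>j>i. walk_rel h i j"
    then obtain j where "j > i" "walk_rel h i j" by blast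
    hence "h (2 * i - 1) \<le> h (2 * i)" using walk_relD(2)[of h i j "2 * i"] by simp
    thus "h (2 * i) = h (2 * i - 1) + 1" using step[of "2 * i - 1"] by simp
  next
    assume u: "h (2 * i) = h (2 * i - 1) + 1"
    \<comment> \<open>The target time is the point \<open>i\<close> one period later, where the walk
      has the same height again.\<close>
    obtain t where t: "2 * i < t" "h t = h (2 * i - 1)"
        "\<And>s. 2 * i \<le> s \<Longrightarrow> s < t \<Longrightarrow> h (2 * i - 1) < h s"
    proof (rule first_hit[of h "h (2 * i - 1)" "2 * i" "2 * i - 1 + 2 * int d"])
      show "h (2 * i - 1 + 2 * int d) \<le> h (2 * i - 1)" using per[of "2 * i - 1"] by simp
    qed (use step u \<open>d \<ge> 1\<close> in auto)
    have "odd t" using par[of t] par[of "2 * i - 1"] t(2) by simp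
    then obtain k where "t = 2 * k + 1" by (rule oddE)
    then obtain j where j: "t = 2 * j - 1" using that[of "k + 1"] by simp
    have "h (2 * i - 1) \<le> h s" if "2 * i - 1 \<le> s" "s \<le> t" for s
      using t(2) t(3)[of s] that by (cases "s = 2 * i - 1"; cases "s = t") auto
    hence "walk_rel h i j" using t j by (auto simp: walk_rel_def min_def max_def)
    thus "\<exists>j>i. walk_rel h i j" using t(1) j by (intro exI[of _ j]) auto
  qed
  have down: "(\<exists>j<i. walk_rel h j i) \<longleftrightarrow> h (2 * i - 2) = h (2 * i - 1) + 1" for i
  proof
    assume "\<exists>j<i. walk_rel h j i"
    then obtain j where "j < i" "walk_rel h j i" by blast
    hence "h (2 * i - 1) \<le> h (2 * i - 2)" using walk_relD(2)[of h j i "2 * i - 2"] walk_relD(1)[of h j i] by simp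
    thus "h (2 * i - 2) = h (2 * i - 1) + 1" using step[of "2 * i - 2"] by simp
  next
    assume u: "h (2 * i - 2) = h (2 * i - 1) + 1"
    obtain t where t: "t < 2 * i - 2" "h t = h (2 * i - 1)"
        "\<And>s. t < s \<Longrightarrow> s \<le> 2 * i - 2 \<Longrightarrow> h (2 * i - 1) < h s"
    proof (rule last_hit[of h "h (2 * i - 1)" "2 * i - 2" "2 * i - 1 - 2 * int d"])
      show "h (2 * i - 1 - 2 * int d) \<le> h (2 * i - 1)" using per[of "2 * i - 1 - 2 * int d"] by simp
    qed (use step u \<open>d \<ge> 1\<close> in auto)
    have "odd t" using par[of t] par[of "2 * i - 1"] t(2) by simp
    then obtain k where "t = 2 * k + 1" by (rule oddE)
    then obtain j where j: "t = 2 * j - 1" using that[of "k + 1"] by simp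
    have "h (2 * i - 1) \<le> h s" if "t \<le> s" "s \<le> 2 * i - 1" for s
      using t(2) t(3)[of s] that by (cases "s = 2 * i - 1"; cases "s = t") auto
    hence "walk_rel h j i" using t j by (auto simp: walk_rel_def min_def max_def)
    thus "\<exists>j<i. walk_rel h j i" using t(1) j by (intro exI[of _ j]) auto
  qed
  show ?thesis using step up down by (simp add: compatible_def)
qed

lemma compatible_unique:
  assumes g: "compatible R g" "g 0 = 0" and h: "compatible R h" "h 0 = 0"
  shows "g = h"
proof -
  have step: "\<bar>g (t + 1) - g t\<bar> = 1" "\<bar>h (t + 1) - h t\<bar> = 1" for t
    using g(1) h(1) unfolding compatible_def by blast+
  have inc: "g (t + 1) - g t = h (t + 1) - h t" for t
  proof (cases "even t")
    case True
    then obtain k where "t = 2 * k" by blast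
    hence t: "t = 2 * (k + 1) - 2" "t + 1 = 2 * (k + 1) - 1" by auto
    have "(g t = g (t + 1) + 1) = (h t = h (t + 1) + 1)"
      using g(1) h(1) unfolding compatible_def t(2) unfolding t(1) by blast
    thus ?thesis using step[of t] by linarith
  next
    case False
    then obtain k where "t = 2 * k + 1" by (rule oddE)
    hence t: "t = 2 * (k + 1) - 1" "t + 1 = 2 * (k + 1)" by auto
    have "(g (t + 1) = g t + 1) = (h (t + 1) = h t + 1)"
      using g(1) h(1) unfolding compatible_def t(2) unfolding t(1) by blast
    thus ?thesis using step[of t] by linarith
  qed
  have "g t = h t" for t
  proof (induction t rule: int_induct[of _ 0])
    case (step1 i)
    thus ?case using inc[of i] by simp
  next
    case (step2 i)
    thus ?case using inc[of "i - 1"] by simp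
  qed (use g h in simp)
  thus ?thesis by blast
qed

text \<open>A walk can be read back from its relation: two walks with the same relation are both
  compatible with it and start at 0.\<close>

lemma inj_on_walk_rel: "d \<ge> 1 \<Longrightarrow> inj_on walk_rel (walks d)"
  by (rule inj_onI) (metis (mono_tags, lifting) compatible_unique compatible_walk_rel walks_def mem_Collect_eq)

section \<open>Consecutive members of a class\<close>

lemma consecutive_ex_right:
  assumes "R i j" "i < j"
  obtains k where "consecutive R i k" "k \<le> j"
proof -
  define n where "n = (LEAST n::nat. n > 0 \<and> R i (i + int n))"
  have w: "nat (j - i) > 0 \<and> R i (i + int (nat (j - i)))" using assms by simp
  have n: "n > 0 \<and> R i (i + int n)" unfolding n_def by (rule LeastI) (rule w)
  have "n \<le> nat (j - i)" unfolding n_def using w by (rule Least_le)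
  moreover have "\<not> R i k" if "i < k" "k < i + int n" for k
  proof -
    have "nat (k - i) < n" using that by linarith
    hence "\<not> (nat (k - i) > 0 \<and> R i (i + int (nat (k - i))))" unfolding n_def by (rule not_less_Least)
    thus ?thesis using that by simp
  qed
  ultimately show ?thesis using that[of "i + int n"] n assms by (auto simp: consecutive_def)
qed

text \<open>The reflection is \<open>1 - i\<close> because reversing time sends
  \<open>2 * i - 1\<close>, the time of the point \<open>i\<close>, to
  \<open>2 * (1 - i) - 1\<close>.\<close>

lemma consecutive_mirror:
  assumes "equivp R"
  shows "consecutive (\<lambda>i j. R (1 - i) (1 - j)) i j \<longleftrightarrow> consecutive R (1 - j) (1 - i)"
proof -
  have *: "R (1 - j) k \<longleftrightarrow> R (1 - i) k" "R (1 - j) (1 - i)" if "R (1 - i) (1 - j)" for k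
    using assms that by (meson equivp_symp equivp_transp)+
  have **: "R (1 - i) (1 - j)" if "R (1 - j) (1 - i)"
    using assms that by (meson equivp_symp)
  have "(\<forall>k. i < k \<and> k < j \<longrightarrow> \<not> R (1 - i) (1 - k)) \<longleftrightarrow> (\<forall>k. 1 - j < k \<and> k < 1 - i \<longrightarrow> \<not> R (1 - i) k)"
    (is "?A \<longleftrightarrow> ?B")
  proof
    assume ?A
    show ?B
    proof (intro allI impI)
      fix k assume "1 - j < k \<and> k < 1 - i"
      thus "\<not> R (1 - i) k" using \<open>?A\<close>[rule_format, of "1 - k"] by simp
    qed
  next
    assume ?B
    show ?A
    proof (intro allI impI)
      fix k assume "i < k \<and> k < j"
      thus "\<not> R (1 - i) (1 - k)" using \<open>?B\<close>[rule_format, of "1 - k"] by simp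
    qed
  qed
  thus ?thesis using * ** by (auto simp: consecutive_def)
qed

lemma consecutive_ex_left:
  assumes "equivp R" "R i j" "i < j"
  obtains k where "consecutive R k j" "i \<le> k"
proof -
  have "R (1 - (1 - j)) (1 - (1 - i))" using assms by (simp add: equivp_symp)
  then obtain k where "consecutive (\<lambda>i j. R (1 - i) (1 - j)) (1 - j) k" "k \<le> 1 - i"
    using consecutive_ex_right[of "\<lambda>i j. R (1 - i) (1 - j)" "1 - j" "1 - i"] assms(3) by auto
  thus ?thesis using that[of "1 - k"] consecutive_mirror[OF assms(1), of "1 - j" k] by simp
qed

lemma consecutive_unique:
  assumes "equivp R"
  shows "consecutive R i j \<Longrightarrow> consecutive R i k \<Longrightarrow> j = k"
    and "consecutive R i k \<Longrightarrow> consecutive R j k \<Longrightarrow> i = j"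
proof -
  show "j = k" if "consecutive R i j" "consecutive R i k"
    using that unfolding consecutive_def by (meson linorder_neqE)
  show "i = j" if c: "consecutive R i k" "consecutive R j k"
  proof -
    have "R i j" "R j i" using c assms unfolding consecutive_def by (meson equivp_symp equivp_transp)+
    thus ?thesis using c unfolding consecutive_def by (meson linorder_neqE)
  qed
qed

section \<open>A compatible walk determines the relation\<close>

lemma compatible_mirror:
  assumes "equivp R" and c: "compatible R h"
  shows "compatible (\<lambda>i j. R (1 - i) (1 - j)) (\<lambda>t. h (- t))"
proof -
  have sym: "R a b = R b a" for a b using assms(1) by (meson equivp_symp)
  have "\<bar>h (- (t + 1)) - h (- t)\<bar> = 1" for t
    using c[unfolded compatible_def, THEN conjunct1, rule_format, of "- t - 1"]
    by (simp add: abs_minus_commute)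
  moreover have "(\<exists>j>i. R (1 - i) (1 - j)) \<longleftrightarrow> h (- (2 * i)) = h (- (2 * i - 1)) + 1" for i
  proof -
    have "(\<exists>j>i. R (1 - i) (1 - j)) \<longleftrightarrow> (\<exists>k<1 - i. R k (1 - i))"
    proof
      assume "\<exists>j>i. R (1 - i) (1 - j)"
      then obtain j where "j > i" "R (1 - i) (1 - j)" by blast
      thus "\<exists>k<1 - i. R k (1 - i)" using sym by (intro exI[of _ "1 - j"]) auto
    next
      assume "\<exists>k<1 - i. R k (1 - i)"
      then obtain k where "k < 1 - i" "R k (1 - i)" by blast
      thus "\<exists>j>i. R (1 - i) (1 - j)" using sym by (intro exI[of _ "1 - k"]) auto
    qed
    thus ?thesis
      using c[unfolded compatible_def, THEN conjunct2, THEN conjunct2, rule_format, of "1 - i"] by simp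
  qed
  moreover have "(\<exists>j<i. R (1 - j) (1 - i)) \<longleftrightarrow> h (- (2 * i - 2)) = h (- (2 * i - 1)) + 1" for i
  proof -
    have "(\<exists>j<i. R (1 - j) (1 - i)) \<longleftrightarrow> (\<exists>k>1 - i. R (1 - i) k)"
    proof
      assume "\<exists>j<i. R (1 - j) (1 - i)"
      then obtain j where "j < i" "R (1 - j) (1 - i)" by blast
      thus "\<exists>k>1 - i. R (1 - i) k" using sym by (intro exI[of _ "1 - j"]) auto
    next
      assume "\<exists>k>1 - i. R (1 - i) k"
      then obtain k where "k > 1 - i" "R (1 - i) k" by blast
      thus "\<exists>j<i. R (1 - j) (1 - i)" using sym by (intro exI[of _ "1 - k"]) auto
    qed
    thus ?thesis
      using c[unfolded compatible_def, THEN conjunct2, THEN conjunct1, rule_format, of "1 - i"] by simp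
  qed
  ultimately show ?thesis unfolding compatible_def by blast
qed

text \<open>By noncrossing, the classes of points strictly between \<open>i\<close> and
  \<open>j\<close> cannot reach left of \<open>i\<close>. Such a point either has an earlier
  companion inside the gap, whose height it shares by \<open>level\<close>, or is reached by an up
  step. So the walk, having risen after \<open>i\<close>, stays strictly above. The hypothesis
  \<open>level\<close> is what an induction on the distance supplies.\<close>

lemma consecutive_climb:
  assumes eq: "equivp R" and nc: "noncrossing R" and c: "compatible R h" and ij: "consecutive R i j"
    and level: "\<And>p q. i < p \<Longrightarrow> p < q \<Longrightarrow> q < j \<Longrightarrow> R p q \<Longrightarrow> h (2 * p - 1) = h (2 * q - 1)"
  shows "2 * i - 1 < t \<Longrightarrow> t < 2 * j - 1 \<Longrightarrow> h (2 * i - 1) < h t"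
    and "h (2 * i - 1) \<le> h (2 * j - 1)"
proof -
  have step: "\<And>t. \<bar>h (t + 1) - h t\<bar> = 1"
    and up: "\<And>i. (\<exists>j>i. R i j) \<longleftrightarrow> h (2 * i) = h (2 * i - 1) + 1"
    and down: "\<And>i. (\<exists>j<i. R j i) \<longleftrightarrow> h (2 * i - 2) = h (2 * i - 1) + 1"
    using c by (auto simp: compatible_def)
  have ij': "i < j" "R i j" "\<And>k. i < k \<Longrightarrow> k < j \<Longrightarrow> \<not> R i k"
    using ij by (auto simp: consecutive_def)
  have base: "h (2 * i) = h (2 * i - 1) + 1" using up[of i] ij' by blast
  have "i < k \<Longrightarrow> k < j \<Longrightarrow> h (2 * i - 1) + 2 \<le> h (2 * k - 1)" for k
  proof (induction "nat (k - i)" arbitrary: k rule: less_induct)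
    case less
    show ?case
    proof (cases "\<exists>p<k. R p k")
      case True
      then obtain p where p: "p < k" "R p k" by blast
      \<comment> \<open>If \<open>p < i\<close>, then \<open>p < i < k < j\<close> would interlace
        and put \<open>p\<close>, hence \<open>k\<close>, into the class of \<open>i\<close>,
        although \<open>j\<close> is the next member after \<open>i\<close>.\<close>
      have "p > i"
      proof (rule ccontr)
        assume "\<not> p > i"
        hence "R p i" using nc p ij' less.prems eq unfolding noncrossing_def
          by (metis equivp_reflp linorder_neqE)
        hence "R i k" using p eq by (meson equivp_symp equivp_transp)
        thus False using ij' less.prems by blast
      qed
      have "h (2 * i - 1) + 2 \<le> h (2 * p - 1)"
        by (rule less.hyps) (use p less.prems \<open>p > i\<close> in auto)
      thus ?thesis using level[of p k] p less.prems \<open>p > i\<close> by simp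
    next
      case False
      hence k: "h (2 * k - 1) = h (2 * k - 2) + 1"
        using down[of k] step[of "2 * k - 2"] by auto
      show ?thesis
      proof (cases "k = i + 1")
        case True
        thus ?thesis using base k by simp
      next
        case False
        \<comment> \<open>The step after \<open>k - 1\<close> loses at most one unit of height, and
          the up step into \<open>k\<close> regains it.\<close>
        hence "h (2 * i - 1) + 2 \<le> h (2 * (k - 1) - 1)"
          by (intro less.hyps) (use less.prems in auto)
        thus ?thesis using k step[of "2 * (k - 1) - 1"] by simp
      qed
    qed
  qed
  note odd = this
  have even: "h (2 * i - 1) + 1 \<le> h (2 * k)" if "i \<le> k" "k < j" for k
    using odd[of k] that base step[of "2 * k - 1"] by (cases "k = i") auto
  show "h (2 * i - 1) < h t" if t: "2 * i - 1 < t" "t < 2 * j - 1" for t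
  proof (cases "even t")
    case True
    then obtain k where "t = 2 * k" by blast
    thus ?thesis using even[of k] t by simp
  next
    case False
    then obtain k where "t = 2 * k + 1" by (rule oddE)
    hence "t = 2 * (k + 1) - 1" by simp
    thus ?thesis using odd[of "k + 1"] t by simp
  qed
  show "h (2 * i - 1) \<le> h (2 * j - 1)"
    using even[of "j - 1"] ij'(1) step[of "2 * j - 2"] by simp
qed

text \<open>Induction on the distance. A pair that is not consecutive splits at an intermediate
  member of its class; for a consecutive pair the shorter pairs provide the hypothesis
  \<open>level\<close> of \<open>consecutive_climb\<close>.\<close>

lemma compatible_imp_walk_rel:
  assumes eq: "equivp R" and nc: "noncrossing R" and c: "compatible R h"
  shows "i < j \<Longrightarrow> R i j \<Longrightarrow> walk_rel h i j"
proof (induction "nat (j - i)" arbitrary: i j rule: less_induct)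
  case less
  show ?case
  proof (cases "consecutive R i j")
    case True
    have level: "h (2 * p - 1) = h (2 * q - 1)" if "i < p" "p < q" "q < j" "R p q" for p q
      using less.hyps[of q p] that by (auto simp: walk_rel_def)
    \<comment> \<open>climbing to the right gives one inequality between the end heights, the mirror image the other\<close>
    let ?R = "\<lambda>i j. R (1 - i) (1 - j)" and ?h = "\<lambda>t. h (- t)"
    have "equivp ?R"
      using eq unfolding equivp_def by metis
    moreover have "noncrossing ?R"
      unfolding noncrossing_def
    proof (intro allI impI)
      fix a b x e
      assume *: "a < b \<and> b < x \<and> x < e \<and> R (1 - a) (1 - x) \<and> R (1 - b) (1 - e)"
      have "R (1 - e) (1 - x)"
        using nc[unfolded noncrossing_def, rule_format, of "1 - e" "1 - x" "1 - b" "1 - a"] * eq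
        by (meson diff_strict_left_mono equivp_symp)
      thus "R (1 - a) (1 - b)" using * eq by (meson equivp_symp equivp_transp)
    qed
    moreover have "h (- (2 * p - 1)) = h (- (2 * q - 1))"
      if "1 - j < p" "p < q" "q < 1 - i" "R (1 - p) (1 - q)" for p q
      using level[of "1 - q" "1 - p"] that eq by (simp add: equivp_symp)
    ultimately have "?h (2 * (1 - j) - 1) \<le> ?h (2 * (1 - i) - 1)"
      using compatible_mirror[OF eq c] consecutive_mirror[OF eq, of "1 - j" "1 - i"] True
      by (intro consecutive_climb(2)[of ?R]) auto
    hence "h (2 * j - 1) \<le> h (2 * i - 1)" by simp
    hence e: "h (2 * i - 1) = h (2 * j - 1)"
      using consecutive_climb(2)[OF eq nc c True level] by simp
    have "h (2 * i - 1) \<le> h t" if t: "2 * i - 1 \<le> t" "t \<le> 2 * j - 1" for t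
    proof -
      consider "t = 2 * i - 1" | "t = 2 * j - 1" | "2 * i - 1 < t" "t < 2 * j - 1"
        using t by linarith
      thus ?thesis
      proof cases
        case 3
        thus ?thesis using consecutive_climb(1)[OF eq nc c True level, of t] by simp
      qed (use e in simp_all)
    qed
    thus ?thesis using e less.prems by (intro walk_relI) auto
  next
    case False
    then obtain k where k: "i < k" "k < j" "R i k"
      using less.prems by (auto simp: consecutive_def)
    have "R k j" using k less.prems eq by (meson equivp_symp equivp_transp)
    hence "walk_rel h i k" "walk_rel h k j" using less.hyps k by auto
    thus ?thesis using equivp_walk_rel by (meson equivp_transp)
  qed
qed

text \<open>The walk must rise after \<open>i\<close>, so \<open>i\<close> has a next companion
  \<open>k\<close>. It cannot lie beyond \<open>j\<close>, because between \<open>i\<close> and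
  \<open>k\<close> the walk is strictly higher than at \<open>i\<close>. The argument then continues
  with the shorter pair \<open>k\<close>, \<open>j\<close>.\<close>

lemma walk_rel_imp_compatible:
  assumes eq: "equivp R" and nc: "noncrossing R" and c: "compatible R h"
  shows "i < j \<Longrightarrow> walk_rel h i j \<Longrightarrow> R i j"
proof (induction "nat (j - i)" arbitrary: i j rule: less_induct)
  case less
  have "h (2 * i - 1) \<le> h (2 * i)"
    using less.prems walk_relD(2)[of h i j "2 * i"] by simp
  hence "h (2 * i) = h (2 * i - 1) + 1"
    using c[unfolded compatible_def, THEN conjunct1, rule_format, of "2 * i - 1"] by simp
  then obtain k' where "i < k'" "R i k'" using c unfolding compatible_def by blast
  then obtain k where k: "consecutive R i k" using consecutive_ex_right by blast
  have "h (2 * p - 1) = h (2 * q - 1)" if "p < q" "R p q" for p q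
    using compatible_imp_walk_rel[OF eq nc c that] by (simp add: walk_rel_def)
  hence "h (2 * i - 1) < h (2 * j - 1)" if "j < k"
    using consecutive_climb(1)[OF eq nc c k, of "2 * j - 1"] that less.prems by auto
  moreover have "h (2 * i - 1) = h (2 * j - 1)" using less.prems by (simp add: walk_rel_def)
  ultimately have "k \<le> j" by fastforce
  have ik: "i < k" "R i k" using k by (auto simp: consecutive_def)
  show ?case
  proof (cases "k = j")
    case False
    have "walk_rel h i k" by (rule compatible_imp_walk_rel[OF eq nc c ik])
    hence "walk_rel h k j" using less.prems equivp_walk_rel by (meson equivp_symp equivp_transp)
    hence "R k j" using less.hyps[of j k] ik \<open>k \<le> j\<close> False by auto
    thus ?thesis using ik eq by (meson equivp_transp)
  qed (use ik in simp)
qed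

lemma walk_rel_eq_compatible:
  assumes eq: "equivp R" and nc: "noncrossing R" and c: "compatible R h"
  shows "walk_rel h = R"
proof -
  have "walk_rel h i j = R i j" if "i < j" for i j
    using compatible_imp_walk_rel[OF assms that] walk_rel_imp_compatible[OF assms that] by blast
  hence "walk_rel h i j = R i j" for i j
    using eq equivp_walk_rel[of h] by (metis equivp_reflp equivp_symp linorder_neqE)
  thus ?thesis by blast
qed

section \<open>Existence of a compatible walk\<close>

lemma int_periodic:
  fixes f :: "int \<Rightarrow> 'a"
  assumes "\<And>t. f (t + p) = f t"
  shows "f (t + k * p) = f t"
proof (induction k rule: int_induct[of _ 0])
  case (step1 i)
  thus ?case using assms[of "t + i * p"] by (simp add: algebra_simps)
next
  case (step2 i)
  thus ?case using assms[of "t + (i - 1) * p"] by (simp add: algebra_simps)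
qed simp

lemma periodic_ncrel_shift:
  assumes "R \<in> periodic_ncrel d"
  shows "R (i + k * int d) (j + k * int d) = R i j"
proof -
  have per: "R (i + int d) (j + int d) = R i j" for i j
    using assms by (simp add: periodic_ncrel_def)
  have "(\<lambda>t. R (i + t) (j + t)) (0 + k * int d) = (\<lambda>t. R (i + t) (j + t)) 0"
  proof (rule int_periodic)
    show "R (i + (t + int d)) (j + (t + int d)) = R (i + t) (j + t)" for t
      using per[of "i + t" "j + t"] by (simp add: add.assoc)
  qed
  thus ?thesis by simp
qed

lemma consecutive_shift:
  assumes "R \<in> periodic_ncrel d" "consecutive R i j"
  shows "consecutive R (i + k * int d) (j + k * int d)"
proof -
  have "\<not> R (i + k * int d) l" if "i + k * int d < l" "l < j + k * int d" for l
    using assms(2) that periodic_ncrel_shift[OF assms(1), of i k "l - k * int d"]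
    by (auto simp: consecutive_def)
  thus ?thesis using assms(2) periodic_ncrel_shift[OF assms(1)] by (simp add: consecutive_def)
qed

lemma mod_shift:
  fixes i d :: int
  obtains m where "(i - 1) mod d + 1 = i + m * d"
proof -
  have "(i - 1) mod d + 1 = i + - ((i - 1) div d) * d"
    using div_mult_mod_eq[of "i - 1" d] by (simp add: algebra_simps)
  thus ?thesis using that by blast
qed

text \<open>Passing to the next member of the class and reducing to {1..d} is a bijection; its
  inverse passes to the previous member. This balance is what makes the encoding walk
  closed.\<close>

lemma card_left_eq_card_right:
  assumes R: "R \<in> periodic_ncrel d" and "d \<ge> 1"
  shows "card {i\<in>{1..int d}. \<exists>j>i. R i j} = card {j\<in>{1..int d}. \<exists>i<j. R i j}"
    (is "card ?A = card ?B")
proof -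
  have eq: "equivp R" using R by (simp add: periodic_ncrel_def)
  let ?rep = "\<lambda>i. (i - 1) mod int d + 1"
  define f where "f i = ?rep (THE j. consecutive R i j)" for i
  define g where "g j = ?rep (THE i. consecutive R i j)" for j
  have rep_range: "?rep i \<in> {1..int d}" for i
  proof -
    have "0 < int d" using \<open>d \<ge> 1\<close> by simp
    from pos_mod_bound[OF this, of "i - 1"] pos_mod_sign[OF this, of "i - 1"]
    show ?thesis unfolding atLeastAtMost_iff by linarith
  qed
  have rep_id: "?rep i = i" if "i \<in> {1..int d}" for i using that by simp
  have rep_shift: "?rep (i + m * int d) = ?rep i" for i m
    using mod_mult_self1[of "i - 1" m "int d"] by (simp add: algebra_simps)
  have the_right: "(THE j. consecutive R i j) = j" if "consecutive R i j" for i j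
    using that consecutive_unique(1)[OF eq] by blast
  have the_left: "(THE i. consecutive R i j) = i" if "consecutive R i j" for i j
    using that consecutive_unique(2)[OF eq] by blast
  have fA: "f i \<in> ?B \<and> g (f i) = i" if "i \<in> ?A" for i
  proof -
    obtain k where "R i k" "i < k" using \<open>i \<in> ?A\<close> by blast
    then obtain j where j: "consecutive R i j" using consecutive_ex_right[of R i k] by metis
    obtain m where m: "?rep j = j + m * int d" by (rule mod_shift)
    \<comment> \<open>The pair \<open>i\<close>, \<open>j\<close> is translated until its right end
      lies in the window; stepping back from there gives a translate of \<open>i\<close>, whose
      representative is \<open>i\<close>.\<close>
    have c: "consecutive R (i + m * int d) (?rep j)" unfolding m by (rule consecutive_shift[OF R j])
    have "f i = ?rep j" using the_right[OF j] by (simp add: f_def)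
    moreover have "g (?rep j) = i"
      using the_left[OF c] rep_shift rep_id that unfolding g_def by simp
    moreover have "?rep j \<in> ?B" using c rep_range[of j] by (auto simp: consecutive_def)
    ultimately show ?thesis by simp
  qed
  have gB: "g j \<in> ?A \<and> f (g j) = j" if "j \<in> ?B" for j
  proof -
    obtain k where "R k j" "k < j" using \<open>j \<in> ?B\<close> by blast
    then obtain i where i: "consecutive R i j" using consecutive_ex_left[OF eq, of k j] by metis
    obtain m where m: "?rep i = i + m * int d" by (rule mod_shift)
    have c: "consecutive R (?rep i) (j + m * int d)" unfolding m by (rule consecutive_shift[OF R i])
    have "g j = ?rep i" using the_left[OF i] by (simp add: g_def)
    moreover have "f (?rep i) = j"
      using the_right[OF c] rep_shift rep_id that unfolding f_def by simp
    moreover have "?rep i \<in> ?A" using c rep_range[of i] by (auto simp: consecutive_def)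
    ultimately show ?thesis by simp
  qed
  have "bij_betw f ?A ?B"
    by (rule bij_betwI[of _ _ _ g]) (use fA gB in auto)
  thus ?thesis by (rule bij_betw_same_card)
qed

text \<open>A periodic pattern of up and down steps integrates to a periodic walk when half of the
  steps in a period go up. Within a period the height is twice the number of up steps minus the
  elapsed time.\<close>

lemma walk_exists:
  assumes "d \<ge> 1" and per: "\<And>t. s (t + 2 * int d) = s t"
    and card: "card {t\<in>{0..<2 * int d}. s t} = d"
  obtains h where "h \<in> walks d" "\<And>t. h (t + 1) - h t = (if s t then 1 else - 1)"
proof -
  define D where "D = 2 * int d"
  have "D > 0" using \<open>d \<ge> 1\<close> by (simp add: D_def)
  define c where "c m = int (card {t\<in>{0..<m}. s t})" for m :: int
  define h where "h t = 2 * c (t mod D) - t mod D" for t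
  have c_Suc: "c (m + 1) = c m + (if s m then 1 else 0)" if "m \<ge> 0" for m
  proof -
    have "{t\<in>{0..<m + 1}. s t} = (if s m then insert m {t\<in>{0..<m}. s t} else {t\<in>{0..<m}. s t})"
      using that by (auto simp: order_less_le)
    moreover have "finite {t\<in>{0..<m}. s t}" by (rule finite_subset[of _ "{0..<m}"]) auto
    ultimately show ?thesis by (simp add: c_def)
  qed
  have c0: "c 0 = 0" by (simp add: c_def)
  have cD: "c D = int d" using card by (simp add: c_def D_def)
  have h_Suc: "h (t + 1) = 2 * c (t mod D + 1) - (t mod D + 1)" for t
  proof (cases "t mod D + 1 = D")
    \<comment> \<open>The seam between two periods: \<open>d\<close> up steps among
      \<open>2 * d\<close> steps give height 0, the value from which the next period starts.\<close>
    case True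
    hence "(t + 1) mod D = 0" by (metis mod_add_left_eq mod_self)
    thus ?thesis using True c0 cD by (simp add: h_def D_def)
  next
    case False
    hence "t mod D + 1 < D" using pos_mod_bound[OF \<open>D > 0\<close>, of t] by simp
    hence "(t + 1) mod D = t mod D + 1"
      using pos_mod_sign[OF \<open>D > 0\<close>, of t] by (metis add_nonneg_nonneg mod_add_left_eq mod_pos_pos_trivial zero_le_one)
    thus ?thesis by (simp add: h_def)
  qed
  have s_mod: "s (t mod D) = s t" for t
    using int_periodic[of s D "t mod D" "t div D"] per unfolding D_def mod_div_mult_eq by metis
  have step: "h (t + 1) - h t = (if s t then 1 else - 1)" for t
    unfolding h_Suc using c_Suc[of "t mod D"] pos_mod_sign[OF \<open>D > 0\<close>, of t] s_mod[of t]
    by (simp add: h_def)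
  moreover have "h \<in> walks d"
    using step by (auto simp: walks_def h_def c0 simp flip: D_def)
  ultimately show ?thesis using that by blast
qed

lemma compatible_walk_exists:
  assumes R: "R \<in> periodic_ncrel d" and "d \<ge> 1"
  obtains h where "h \<in> walks d" "compatible R h"
proof -
  define A where "A = {i. \<exists>j>i. R i j}"
  define B where "B = {j. \<exists>i<j. R i j}"
  have per: "R (i + int d) (j + int d) = R i j" for i j
    using R by (simp add: periodic_ncrel_def)
  have perA: "i + int d \<in> A \<longleftrightarrow> i \<in> A" for i
  proof
    assume "i + int d \<in> A"
    then obtain j where j: "i + int d < j" "R (i + int d) j" by (auto simp: A_def)
    thus "i \<in> A" using per[of i "j - int d"] by (auto simp: A_def intro!: exI[of _ "j - int d"])
  next
    assume "i \<in> A"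
    then obtain j where "i < j" "R i j" by (auto simp: A_def)
    thus "i + int d \<in> A" using per[of i j] by (auto simp: A_def intro!: exI[of _ "j + int d"])
  qed
  have perB: "i + int d \<in> B \<longleftrightarrow> i \<in> B" for i
  proof
    assume "i + int d \<in> B"
    then obtain j where j: "i + int d > j" "R j (i + int d)" by (auto simp: B_def)
    thus "i \<in> B" using per[of "j - int d" i] by (auto simp: B_def intro!: exI[of _ "j - int d"])
  next
    assume "i \<in> B"
    then obtain j where "j < i" "R j i" by (auto simp: B_def)
    thus "i + int d \<in> B" using per[of j i] by (auto simp: B_def intro!: exI[of _ "j + int d"])
  qed
  \<comment> \<open>An even time \<open>2 * i - 2\<close> precedes the point \<open>i\<close>, where
    a smaller companion means a down step; an odd time \<open>2 * i - 1\<close> is the point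
    \<open>i\<close> itself, where a larger companion means an up step.\<close>
  define s where "s t = (if even t then t div 2 + 1 \<notin> B else (t + 1) div 2 \<in> A)" for t :: int
  have s_even: "s (2 * i - 2) \<longleftrightarrow> i \<notin> B" and s_odd: "s (2 * i - 1) \<longleftrightarrow> i \<in> A" for i
    by (auto simp: s_def)
  have sper: "s (t + 2 * int d) = s t" for t
  proof (cases "even t")
    case True
    then obtain k where "t = 2 * k" by blast
    thus ?thesis using perB[of "k + 1"] by (simp add: s_def add_ac)
  next
    case False
    then obtain k where "t = 2 * k + 1" by (rule oddE)
    thus ?thesis using perA[of "k + 1"] by (simp add: s_def add_ac)
  qed
  \<comment> \<open>Within one period the up steps number \<open>d\<close> minus the points with a
    smaller companion plus the points with a larger one, and these two counts agree.\<close>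
  have "card {t\<in>{0..<2 * int d}. s t} = d"
  proof -
    let ?I = "{1..int d}"
    have split: "{t\<in>{0..<2 * int d}. s t} = (\<lambda>i. 2 * i - 2) ` (?I - B) \<union> (\<lambda>i. 2 * i - 1) ` (?I \<inter> A)"
      (is "?L = ?M \<union> ?N")
    proof
      show "?L \<subseteq> ?M \<union> ?N"
      proof
        fix t assume t: "t \<in> ?L"
        show "t \<in> ?M \<union> ?N"
        proof (cases "even t")
          case True
          then obtain k where "t = 2 * k" by blast
          hence "t = 2 * (k + 1) - 2" "k + 1 \<in> ?I - B" using t s_even[of "k + 1"] by auto
          thus ?thesis by blast
        next
          case False
          then obtain k where "t = 2 * k + 1" by (rule oddE)
          hence k: "t = 2 * (k + 1) - 1" by simp
          moreover have "k + 1 \<in> ?I \<inter> A" using t s_odd[of "k + 1"] unfolding k by auto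
          ultimately
          show ?thesis by blast
        qed
      qed
    qed (auto simp: s_even s_odd)
    have "?M \<inter> ?N = {}"
    proof -
      have "2 * i - 2 \<noteq> 2 * j - (1::int)" for i j by presburger
      thus ?thesis by auto
    qed
    hence "card {t\<in>{0..<2 * int d}. s t} = card ?M + card ?N"
      unfolding split by (intro card_Un_disjoint) auto
    also have "card ?M = card (?I - B)" by (rule card_image) (auto simp: inj_on_def)
    also have "card ?N = card (?I \<inter> A)" by (rule card_image) (auto simp: inj_on_def)
    also have "?I \<inter> A = {i\<in>?I. \<exists>j>i. R i j}" by (auto simp: A_def)
    also have "card \<dots> = card {j\<in>?I. \<exists>i<j. R i j}"
      by (rule card_left_eq_card_right[OF R \<open>d \<ge> 1\<close>])
    also have "{j\<in>?I. \<exists>i<j. R i j} = ?I \<inter> B" by (auto simp: B_def)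
    also have "card (?I - B) + card (?I \<inter> B) = card ?I"
      by (metis add.commute card_Int_Diff finite_atLeastAtMost_int)
    finally show ?thesis by simp
  qed
  then obtain h where h: "h \<in> walks d" and step: "\<And>t. h (t + 1) - h t = (if s t then 1 else - 1)"
    using walk_exists[of d s] \<open>d \<ge> 1\<close> sper by blast
  have "compatible R h"
    unfolding compatible_def
  proof (intro conjI allI)
    show "\<bar>h (t + 1) - h t\<bar> = 1" for t using step[of t] by simp
    show "(\<exists>j>i. R i j) \<longleftrightarrow> h (2 * i) = h (2 * i - 1) + 1" for i
      using step[of "2 * i - 1"] s_odd[of i] by (auto simp: A_def split: if_splits)
    show "(\<exists>j<i. R j i) \<longleftrightarrow> h (2 * i - 2) = h (2 * i - 1) + 1" for i
      using step[of "2 * i - 2"] s_even[of i] by (auto simp: B_def split: if_splits)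
  qed
  thus ?thesis using that h by blast
qed

lemma bij_betw_walk_rel:
  assumes "d \<ge> 1"
  shows "bij_betw walk_rel (walks d) (periodic_ncrel d)"
  unfolding bij_betw_def
proof
  show "walk_rel ` walks d = periodic_ncrel d"
  proof
    show "periodic_ncrel d \<subseteq> walk_rel ` walks d"
    proof
      fix R assume R: "R \<in> periodic_ncrel d"
      obtain h where h: "h \<in> walks d" "compatible R h"
        using compatible_walk_exists[OF R assms] .
      have "walk_rel h = R"
        using R h(2) by (intro walk_rel_eq_compatible) (auto simp: periodic_ncrel_def)
      thus "R \<in> walk_rel ` walks d" using h(1) by blast
    qed
  qed (use walk_rel_in_periodic_ncrel in blast)
qed (rule inj_on_walk_rel[OF assms])

section \<open>Counting walks\<close>

text \<open>Such a \<open>W\<close> is the set of positions of the up steps in a path of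
  \<open>n\<close> steps, \<open>k\<close> of them up; the inequality for \<open>m\<close> says that
  the path is not below 0 after \<open>m\<close> steps. For \<open>n = 2 * k\<close> these are the
  Dyck paths.\<close>

definition ballot_sets :: "nat \<Rightarrow> nat \<Rightarrow> nat set set" where
  "ballot_sets n k = {W. W \<subseteq> {..<n} \<and> card W = k \<and> (\<forall>m\<le>n. m \<le> 2 * card (W \<inter> {..<m}))}"

lemma finite_ballot_sets: "finite (ballot_sets n k)"
  by (rule finite_subset[of _ "Pow {..<n}"]) (auto simp: ballot_sets_def)

text \<open>Case distinction on the last step. The assumption says that the final height is
  nonnegative, so only the conditions on shorter prefixes remain.\<close>

lemma ballot_sets_Suc:
  assumes "Suc n \<le> 2 * Suc k"
  shows "ballot_sets (Suc n) (Suc k) = insert n ` ballot_sets n k \<union> ballot_sets n (Suc k)"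
proof
  show "ballot_sets (Suc n) (Suc k) \<subseteq> insert n ` ballot_sets n k \<union> ballot_sets n (Suc k)"
  proof
    fix W assume "W \<in> ballot_sets (Suc n) (Suc k)"
    hence W: "W \<subseteq> {..<Suc n}" "card W = Suc k" "\<And>m. m \<le> Suc n \<Longrightarrow> m \<le> 2 * card (W \<inter> {..<m})"
      by (auto simp: ballot_sets_def)
    have fin: "finite W" using W(1) finite_subset by blast
    show "W \<in> insert n ` ballot_sets n k \<union> ballot_sets n (Suc k)"
    proof (cases "n \<in> W")
      case True
      have "m \<le> 2 * card ((W - {n}) \<inter> {..<m})" if "m \<le> n" for m
      proof -
        have "(W - {n}) \<inter> {..<m} = W \<inter> {..<m}" using that by auto
        thus ?thesis using W(3)[of m] that by simp
      qed
      hence "W - {n} \<in> ballot_sets n k"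
        using W(1,2) True fin by (auto simp: ballot_sets_def less_Suc_eq)
      thus ?thesis using True by (metis UnI1 imageI insert_Diff)
    next
      case False
      hence "W \<in> ballot_sets n (Suc k)"
        using W by (auto simp: ballot_sets_def less_Suc_eq)
      thus ?thesis by blast
    qed
  qed
next
  have "insert n W \<in> ballot_sets (Suc n) (Suc k)" if "W \<in> ballot_sets n k" for W
  proof -
    have W: "W \<subseteq> {..<n}" "card W = k" "\<And>m. m \<le> n \<Longrightarrow> m \<le> 2 * card (W \<inter> {..<m})"
      using that by (auto simp: ballot_sets_def)
    have fin: "finite W" using W(1) finite_subset by blast
    have c: "card (insert n W) = Suc k" using W fin by (subst card_insert_disjoint) auto
    have "m \<le> 2 * card (insert n W \<inter> {..<m})" if "m \<le> Suc n" for m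
    proof (cases "m = Suc n")
      case True
      moreover have "insert n W \<inter> {..<Suc n} = insert n W" using W(1) by auto
      ultimately show ?thesis using c assms by simp
    next
      case False
      hence "m \<le> n" using that by simp
      moreover from this have "insert n W \<inter> {..<m} = W \<inter> {..<m}" by auto
      ultimately show ?thesis using W(3) by simp
    qed
    thus ?thesis using W(1) c by (auto simp: ballot_sets_def)
  qed
  moreover have "W \<in> ballot_sets (Suc n) (Suc k)" if "W \<in> ballot_sets n (Suc k)" for W
  proof -
    have W: "W \<subseteq> {..<n}" "card W = Suc k" "\<And>m. m \<le> n \<Longrightarrow> m \<le> 2 * card (W \<inter> {..<m})"
      using that by (auto simp: ballot_sets_def)
    have "m \<le> 2 * card (W \<inter> {..<m})" if "m \<le> Suc n" for m
    proof (cases "m = Suc n")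
      case True
      moreover have "W \<inter> {..<Suc n} = W" using W(1) by auto
      ultimately show ?thesis using W(2) assms by simp
    next
      case False
      thus ?thesis using W(3) that by simp
    qed
    moreover have "W \<subseteq> {..<Suc n}" using W(1) by auto
    ultimately show ?thesis using W(2) by (auto simp: ballot_sets_def)
  qed
  ultimately show "insert n ` ballot_sets n k \<union> ballot_sets n (Suc k) \<subseteq> ballot_sets (Suc n) (Suc k)"
    by blast
qed

text \<open>The ballot numbers, in additive form to avoid subtraction on naturals. The range
  includes paths that end at -1, since removing the last up step of a path that ends at 0 leads
  there; no ballot set exists then, and the two binomials coincide by symmetry.\<close>

lemma card_ballot_sets:
  "n \<le> 2 * k + 1 \<Longrightarrow> card (ballot_sets n k) + (n choose Suc k) = n choose k"
proof (induction n arbitrary: k)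
  case 0
  have "ballot_sets 0 k = (if k = 0 then {{}} else {})" by (auto simp: ballot_sets_def)
  thus ?case by (cases k) auto
next
  case (Suc n)
  show ?case
  proof (cases "n = 2 * k")
    case True
    have "\<not> Suc n \<le> 2 * card (W \<inter> {..<Suc n})" if "W \<subseteq> {..<Suc n}" "card W = k" for W
      using that True by (simp add: Int_absorb2)
    hence "ballot_sets (Suc n) k = {}" by (auto simp: ballot_sets_def)
    moreover have "Suc n choose Suc k = Suc n choose k"
      using binomial_symmetric[of k "Suc n"] True by simp
    ultimately show ?thesis by simp
  next
    case False
    then obtain l where k: "k = Suc l" using Suc.prems by (cases k) auto
    have n: "Suc n \<le> 2 * Suc l" using Suc.prems False k by simp
    have "inj_on (insert n) (ballot_sets n l)"
    proof (rule inj_onI)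
      fix V W assume "V \<in> ballot_sets n l" "W \<in> ballot_sets n l" "insert n V = insert n W"
      moreover from this have "n \<notin> V" "n \<notin> W" by (auto simp: ballot_sets_def)
      ultimately show "V = W" by (simp add: insert_ident)
    qed
    moreover have "insert n ` ballot_sets n l \<inter> ballot_sets n (Suc l) = {}"
      by (auto simp: ballot_sets_def)
    ultimately have "card (ballot_sets (Suc n) k) = card (ballot_sets n l) + card (ballot_sets n k)"
      unfolding k ballot_sets_Suc[OF n]
      by (simp add: card_Un_disjoint finite_ballot_sets card_image)
    moreover have "card (ballot_sets n l) + (n choose Suc l) = n choose l"
      "card (ballot_sets n k) + (n choose Suc k) = n choose k"
      using n k by (auto intro!: Suc.IH)
    ultimately show ?thesis using k by simp
  qed
qed

lemma real_card_ballot_sets: "real (card (ballot_sets (2 * n) n)) = catalan n"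
proof -
  have "card (ballot_sets (2 * n) n) + (2 * n choose Suc n) = 2 * n choose n"
    by (rule card_ballot_sets) simp
  hence "real (card (ballot_sets (2 * n) n)) + real (2 * n choose Suc n) = real (2 * n choose n)"
    by (metis of_nat_add)
  moreover have "Suc n * (2 * n choose Suc n) = n * (2 * n choose n)"
    using binomial_absorb_comp[of "2 * n" n] binomial_absorption[of n "2 * n"]
    by (metis add_diff_cancel_right' mult_2)
  hence "real (Suc n) * real (2 * n choose Suc n) = real n * real (2 * n choose n)"
    by (metis of_nat_mult)
  moreover have "Suc n * x = c" if "x + y = c" "real (Suc n) * y = real n * c" for x y c :: real
  proof -
    have "Suc n * x = Suc n * c - Suc n * y" unfolding that(1)[symmetric] by (simp add: algebra_simps)
    also have "\<dots> = c" unfolding that(2) by (simp add: algebra_simps)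
    finally show ?thesis .
  qed
  ultimately have "real (Suc n) * real (card (ballot_sets (2 * n) n)) = real (2 * n choose n)"
    by blast
  thus ?thesis unfolding catalan_def by (simp add: field_simps)
qed

section \<open>Closed walks as choices of up steps\<close>

definition up_steps :: "nat \<Rightarrow> (int \<Rightarrow> int) \<Rightarrow> nat set" where
  "up_steps d h = {t. t < 2 * d \<and> h (int t) < h (int t + 1)}"

lemma walk_height:
  assumes "h \<in> walks d" "m \<le> 2 * d"
  shows "h (int m) = 2 * int (card (up_steps d h \<inter> {..<m})) - int m"
  using assms(2)
proof (induction m)
  case 0
  thus ?case using assms(1) by (simp add: walks_def)
next
  case (Suc m)
  have step: "\<bar>h (int m + 1) - h (int m)\<bar> = 1" using assms(1) by (simp add: walks_def)
  have "up_steps d h \<inter> {..<Suc m} = (if h (int m) < h (int m + 1)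
      then insert m (up_steps d h \<inter> {..<m}) else up_steps d h \<inter> {..<m})"
    using Suc.prems by (auto simp: up_steps_def less_Suc_eq)
  moreover have "finite (up_steps d h \<inter> {..<m})" by simp
  ultimately have "card (up_steps d h \<inter> {..<Suc m}) =
      card (up_steps d h \<inter> {..<m}) + (if h (int m) < h (int m + 1) then 1 else 0)"
    by simp
  hence "int (card (up_steps d h \<inter> {..<Suc m})) =
      int (card (up_steps d h \<inter> {..<m})) + (if h (int m) < h (int m + 1) then 1 else 0)"
    by simp
  moreover have "int (Suc m) = int m + 1" by simp
  moreover have "h (int m) = 2 * int (card (up_steps d h \<inter> {..<m})) - int m"
    using Suc by simp
  ultimately have "h (int m + 1) = 2 * int (card (up_steps d h \<inter> {..<Suc m})) - int (Suc m)"
    using step by (cases "h (int m) < h (int m + 1)") auto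
  thus ?case by (simp add: add.commute)
qed

lemma bij_betw_up_steps:
  assumes "d \<ge> 1"
  shows "bij_betw (up_steps d) (walks d) {W. W \<subseteq> {..<2 * d} \<and> card W = d}"
  unfolding bij_betw_def
proof
  have sub: "up_steps d h \<subseteq> {..<2 * d}" for h by (auto simp: up_steps_def)
  show "inj_on (up_steps d) (walks d)"
  proof (rule inj_onI)
    fix g h assume gh: "g \<in> walks d" "h \<in> walks d" "up_steps d g = up_steps d h"
    have per: "f (t + k * (2 * int d)) = f t" if "f \<in> walks d" for f t k
      using that int_periodic[of f "2 * int d" t k] by (simp add: walks_def)
    show "g = h"
    proof
      fix t
      define m where "m = nat (t mod (2 * int d))"
      have m: "int m = t mod (2 * int d)" "m < 2 * d"
        using assms pos_mod_bound[of "2 * int d" t] pos_mod_sign[of "2 * int d" t]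
        by (auto simp: m_def nat_less_iff)
      have t: "t = int m + (t div (2 * int d)) * (2 * int d)" unfolding m(1) mod_div_mult_eq ..
      have "g (int m) = h (int m)"
        using walk_height[OF gh(1)] walk_height[OF gh(2)] gh(3) m(2) by simp
      thus "g t = h t" using per[OF gh(1)] per[OF gh(2)] t by metis
    qed
  qed
  have card: "card (up_steps d h) = d" if h: "h \<in> walks d" for h
  proof -
    \<comment> \<open>Returning to 0 after a full period forces exactly half of its steps to be
      up.\<close>
    have "h (int (2 * d)) = 0" using h unfolding walks_def
      by (metis (mono_tags, lifting) add_0 mem_Collect_eq of_nat_mult of_nat_numeral)
    moreover have "up_steps d h \<inter> {..<2 * d} = up_steps d h" using sub by blast
    ultimately show ?thesis using walk_height[OF h, of "2 * d"] by simp
  qed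
  show "up_steps d ` walks d = {W. W \<subseteq> {..<2 * d} \<and> card W = d}"
  proof
    show "{W. W \<subseteq> {..<2 * d} \<and> card W = d} \<subseteq> up_steps d ` walks d"
    proof
      fix W assume "W \<in> {W. W \<subseteq> {..<2 * d} \<and> card W = d}"
      hence W: "W \<subseteq> {..<2 * d}" "card W = d" by auto
      define s where "s t = (nat (t mod (2 * int d)) \<in> W)" for t
      have sW: "s (int m) \<longleftrightarrow> m \<in> W" if "m < 2 * d" for m
      proof -
        have "int m mod (2 * int d) = int m" using that by (intro mod_pos_pos_trivial) auto
        thus ?thesis by (simp add: s_def)
      qed
      have "{t\<in>{0..<2 * int d}. s t} = int ` W"
      proof
        show "{t\<in>{0..<2 * int d}. s t} \<subseteq> int ` W"
        proof
          fix t assume t: "t \<in> {t\<in>{0..<2 * int d}. s t}"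
          hence "t = int (nat t)" "nat t \<in> W" using sW[of "nat t"] by auto
          thus "t \<in> int ` W" by blast
        qed
      qed (use W(1) sW in force)
      hence "card {t\<in>{0..<2 * int d}. s t} = d" using W(2) by (simp add: card_image)
      then obtain h where h: "h \<in> walks d" "\<And>t. h (t + 1) - h t = (if s t then 1 else - 1)"
        using walk_exists[of d s] assms by (auto simp: s_def)
      have "h (int t) < h (int t + 1) \<longleftrightarrow> t \<in> W" if "t < 2 * d" for t
        using h(2)[of "int t"] sW[OF that] by (auto split: if_splits)
      hence "up_steps d h = W" using W(1) by (auto simp: up_steps_def)
      thus "W \<in> up_steps d ` walks d" using h(1) by blast
    qed
  qed (use sub card in auto)
qed

lemma card_walks: "d \<ge> 1 \<Longrightarrow> card (walks d) = 2 * d choose d"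
  using bij_betw_same_card[OF bij_betw_up_steps] n_subsets[of "{..<2 * d}" d] by simp

text \<open>One period decides nonnegativity, and there \<open>walk_height\<close> turns it into the
  ballot inequalities for the prefixes.\<close>

lemma card_nonneg_walks:
  assumes "d \<ge> 1"
  shows "real (card {h \<in> walks d. \<forall>t. 0 \<le> h t}) = catalan d"
proof -
  have "(\<forall>t. 0 \<le> h t) \<longleftrightarrow> up_steps d h \<in> ballot_sets (2 * d) d" if h: "h \<in> walks d" for h
  proof -
    have per: "h (t + k * (2 * int d)) = h t" for t k
      using h int_periodic[of h "2 * int d" t k] by (simp add: walks_def)
    have "(\<forall>t. 0 \<le> h t) \<longleftrightarrow> (\<forall>m\<le>2 * d. 0 \<le> h (int m))"
    proof
      assume *: "\<forall>m\<le>2 * d. 0 \<le> h (int m)"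
      show "\<forall>t. 0 \<le> h t"
      proof
        fix t
        have "nat (t mod (2 * int d)) \<le> 2 * d"
          using assms pos_mod_bound[of "2 * int d" t] by linarith
        hence "0 \<le> h (t mod (2 * int d))"
          using * assms pos_mod_sign[of "2 * int d" t] by fastforce
        thus "0 \<le> h t" using per[of "t mod (2 * int d)" "t div (2 * int d)"] unfolding mod_div_mult_eq by simp
      qed
    qed simp
    also have "\<dots> \<longleftrightarrow> (\<forall>m\<le>2 * d. m \<le> 2 * card (up_steps d h \<inter> {..<m}))"
    proof -
      have "0 \<le> h (int m) \<longleftrightarrow> m \<le> 2 * card (up_steps d h \<inter> {..<m})" if "m \<le> 2 * d" for m
        unfolding walk_height[OF h that] by linarith
      thus ?thesis by blast
    qed
    also have "\<dots> \<longleftrightarrow> up_steps d h \<in> ballot_sets (2 * d) d"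
      using bij_betwE[OF bij_betw_up_steps[OF assms]] h by (auto simp: ballot_sets_def)
    finally show ?thesis .
  qed
  hence nonneg: "{h \<in> walks d. \<forall>t. 0 \<le> h t} = {h \<in> walks d. up_steps d h \<in> ballot_sets (2 * d) d}"
    by (intro Collect_cong conj_cong) simp_all
  have sub: "ballot_sets (2 * d) d \<subseteq> up_steps d ` walks d"
    unfolding bij_betw_imp_surj_on[OF bij_betw_up_steps[OF assms]] by (auto simp: ballot_sets_def)
  have "up_steps d ` {h \<in> walks d. up_steps d h \<in> ballot_sets (2 * d) d} =
      up_steps d ` walks d \<inter> ballot_sets (2 * d) d"
    by blast
  hence "up_steps d ` {h \<in> walks d. \<forall>t. 0 \<le> h t} = ballot_sets (2 * d) d"
    unfolding nonneg using sub by blast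
  moreover have "inj_on (up_steps d) {h \<in> walks d. \<forall>t. 0 \<le> h t}"
    using bij_betw_imp_inj_on[OF bij_betw_up_steps[OF assms]] by (rule inj_on_subset) auto
  ultimately show ?thesis
    using card_image[of "up_steps d" "{h \<in> walks d. \<forall>t. 0 \<le> h t}"] real_card_ballot_sets[of d] by simp
qed

section \<open>Wrapping relations on the integers around a circle\<close>

text \<open>Noncrossing relations on the circle, lifted to the integers. Crossings are tested only
  within one turn: all classes are closed under translation by \<open>L\<close>, so any two of them
  interlace as sets of integers, and \<open>noncrossing\<close> would leave only the full
  relation.\<close>

definition cyclic_ncrel :: "nat \<Rightarrow> nat \<Rightarrow> (int \<Rightarrow> int \<Rightarrow> bool) set" where
  "cyclic_ncrel L d =
     {E. equivp E \<and> (\<forall>i. E i (i + int L)) \<and> (\<forall>i j. E (i + int d) (j + int d) = E i j) \<and>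
        (\<forall>a b c e. a < b \<and> b < c \<and> c < e \<and> e < a + int L \<and> E a c \<and> E b e \<longrightarrow> E a b)}"

definition wrap :: "nat \<Rightarrow> (int \<Rightarrow> int \<Rightarrow> bool) \<Rightarrow> int \<Rightarrow> int \<Rightarrow> bool" where
  "wrap L R i j \<longleftrightarrow> (\<exists>k. R i (j + k * int L))"

text \<open>
  Intended for \<open>d\<close>-invariant \<open>E\<close> with \<open>2 * d \<le> L\<close>: the class of \<open>i\<close> is infinite after
  unrolling iff it contains \<open>i + d\<close>, and otherwise it has diameter less than \<open>d\<close>.
\<close>
definition unwrap :: "nat \<Rightarrow> (int \<Rightarrow> int \<Rightarrow> bool) \<Rightarrow> int \<Rightarrow> int \<Rightarrow> bool" where
  "unwrap d E i j \<longleftrightarrow> E i j \<and> (\<bar>i - j\<bar> < int d \<or> E i (i + int d))"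

section \<open>Wrapping a periodic relation\<close>

lemma periodic_ncrel_shift_dvd:
  assumes "R \<in> periodic_ncrel d" "d dvd L"
  shows "R (i + k * int L) (j + k * int L) = R i j"
proof -
  obtain m where "L = d * m" using assms(2) by blast
  hence "k * int L = (k * int m) * int d" by simp
  thus ?thesis using periodic_ncrel_shift[OF assms(1)] by metis
qed

text \<open>A chord of the circle may come from a pair that winds around it several times. Such a
  pair interlaces with one of its own translates by a multiple of \<open>L\<close>, and noncrossing
  then shortens it to one of the two arcs.\<close>

lemma wrap_near:
  assumes R: "R \<in> periodic_ncrel d" "d dvd L" and "wrap L R a c" "a < c" "c < a + int L"
  shows "R a c \<or> R c (a + int L)"
proof -
  have eq: "equivp R" and nc: "noncrossing R" using R by (auto simp: periodic_ncrel_def)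
  note shift = periodic_ncrel_shift_dvd[OF R]
  obtain k where k: "R a (c + k * int L)" using assms(3) by (auto simp: wrap_def)
  have L: "int L > 0" using assms(4,5) by linarith
  have "R a (c + k * int L) \<longleftrightarrow> R (a + (- k) * int L) c"
    using shift[of a "- k" "c + k * int L"] by simp
  with k have k': "R (a - k * int L) c" by simp
  consider "k = 0" | "k > 0" | "k = - 1" | "k < - 1" by linarith
  thus ?thesis
  proof cases
    case 1
    thus ?thesis using k by simp
  next
    \<comment> \<open>The pair and its translate interlace at
      \<open>a - k * int L < a < c < c + k * int L\<close>.\<close>
    case 2
    hence "k * int L > 0" using L by simp
    hence "R (a - k * int L) a"
      using nc k k' assms(4,5) unfolding noncrossing_def
      by (metis add_strict_increasing diff_gt_0_iff_gt less_add_same_cancel1 diff_add_cancel)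
    thus ?thesis using k' eq by (meson equivp_symp equivp_transp)
  next
    case 3
    thus ?thesis using k' eq by (simp add: equivp_symp)
  next
    case 4
    \<comment> \<open>The excess of the witness over one turn. Translating by it yields the
      interlacing \<open>c - x < c < a + int L < a + int L + x\<close>.\<close>
    define x where "x = (- k - 1) * int L"
    have "x > 0" using 4 L by (simp add: x_def)
    have e: "a - k * int L = a + int L + x" by (simp add: x_def algebra_simps)
    have "R (a + int L) (c - x)"
      using shift[of "a + int L + x" "k + 1" c] k' unfolding e by (simp add: x_def algebra_simps)
    hence 1: "R (c - x) (a + int L)" using eq by (simp add: equivp_symp)
    have 2: "R c (a + int L + x)" using k' e eq by (simp add: equivp_symp)
    have "R (c - x) c"
      using nc[unfolded noncrossing_def, rule_format, of "c - x" c "a + int L" "a + int L + x"]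
        1 2 \<open>x > 0\<close> assms(5) by simp
    thus ?thesis using 1 eq by (meson equivp_symp equivp_transp)
  qed
qed

lemma wrap_in_cyclic_ncrel:
  assumes R: "R \<in> periodic_ncrel d" "d dvd L"
  shows "wrap L R \<in> cyclic_ncrel L d"
proof -
  have eq: "equivp R" and nc: "noncrossing R" using R by (auto simp: periodic_ncrel_def)
  have sym: "R i j \<Longrightarrow> R j i" and trans: "R i j \<Longrightarrow> R j k \<Longrightarrow> R i k" for i j k
    using eq by (meson equivp_symp equivp_transp)+
  note shift = periodic_ncrel_shift_dvd[OF R]
  have sub: "R i j \<Longrightarrow> wrap L R i j" for i j
    unfolding wrap_def by (rule exI[of _ 0]) simp
  have "equivp (wrap L R)"
  proof (rule equivpI)
    show "reflp (wrap L R)" using sub eq by (simp add: reflp_def equivp_reflp)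
    show "symp (wrap L R)"
    proof (rule sympI)
      fix i j assume "wrap L R i j"
      then obtain k where "R i (j + k * int L)" by (auto simp: wrap_def)
      hence "R j (i + (- k) * int L)" using shift[of i "- k" "j + k * int L"] sym by simp
      thus "wrap L R j i" unfolding wrap_def by blast
    qed
    show "transp (wrap L R)"
    proof (rule transpI)
      fix i j l assume "wrap L R i j" "wrap L R j l"
      then obtain k m where "R i (j + k * int L)" "R j (l + m * int L)" by (auto simp: wrap_def)
      hence "R i (l + m * int L + k * int L)"
        using shift[of j k "l + m * int L"] trans by blast
      hence "R i (l + (m + k) * int L)" by (simp add: algebra_simps)
      thus "wrap L R i l" unfolding wrap_def by blast
    qed
  qed
  note weq = this
  have per: "wrap L R i (i + int L)" for i
    unfolding wrap_def by (rule exI[of _ "- 1"]) (use eq in \<open>simp add: equivp_reflp\<close>)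
  have "wrap L R (i + int d) (j + int d) = wrap L R i j" for i j
  proof -
    have "R (i + int d) (j + int d + k * int L) = R i (j + k * int L)" for k
    proof -
      have "R (i + int d) (j + k * int L + int d) = R i (j + k * int L)"
        using R by (simp add: periodic_ncrel_def)
      thus ?thesis by (simp add: add_ac)
    qed
    thus ?thesis by (simp add: wrap_def)
  qed
  moreover have "wrap L R a b"
    if o: "a < b" "b < c" "c < e" "e < a + int L" and ac: "wrap L R a c" and be: "wrap L R b e" for a b c e
  proof -
    have cross: "w < x \<Longrightarrow> x < y \<Longrightarrow> y < z \<Longrightarrow> R w y \<Longrightarrow> R x z \<Longrightarrow> R w x" for w x y z
      using nc unfolding noncrossing_def by blast
    \<comment> \<open>Each of the two chords lifts to one of two short pairs, and for every choice
      suitable translates of the pairs interlace as integers.\<close>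
    have "R a c \<or> R c (a + int L)" "R b e \<or> R e (b + int L)"
      using wrap_near[OF R ac] wrap_near[OF R be] o by auto
    then consider "R a c" "R b e" | "R a c" "R e (b + int L)" | "R c (a + int L)" "R b e"
      | "R c (a + int L)" "R e (b + int L)" by blast
    thus ?thesis
    proof cases
      case 1
      thus ?thesis using cross[of a b c e] o sub by blast
    next
      case 2
      have "R (e - int L) b" using shift[of e "- 1" "b + int L"] 2 by simp
      hence "R (e - int L) a" using cross[of "e - int L" a b c] 2 o by simp
      hence "R a b" using \<open>R (e - int L) b\<close> sym trans by blast
      thus ?thesis by (rule sub)
    next
      case 3
      hence "R b c" using cross[of b c e "a + int L"] o by simp
      hence "wrap L R b c" by (rule sub)
      thus ?thesis using ac weq by (meson equivp_symp equivp_transp)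
    next
      case 4
      hence "R c e" using cross[of c e "a + int L" "b + int L"] o by simp
      hence "wrap L R c e" by (rule sub)
      thus ?thesis using ac be weq by (meson equivp_symp equivp_transp)
    qed
  qed
  ultimately show ?thesis using weq per unfolding cyclic_ncrel_def by blast
qed

text \<open>The inverse cuts the circle between \<open>L\<close> and \<open>1\<close>.\<close>
lemma bij_betw_wrap_cut:
  assumes "L \<ge> 1"
  shows "bij_betw (wrap L) {R \<in> periodic_ncrel L. \<forall>i j. i \<le> 0 \<and> 0 < j \<longrightarrow> \<not> R i j} (cyclic_ncrel L L)"
proof -
  \<comment> \<open>The quotient numbers the windows of length \<open>L\<close>, the one numbered 0
    being {1..L}; only relations inside one window survive the cut.\<close>
  let ?cut = "\<lambda>E i j. E i j \<and> (i - 1) div int L = (j - 1) div int L"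
  have L: "int L > 0" using assms by simp
  have div_shift: "(j + k * int L - 1) div int L = (j - 1) div int L + k" for j k
    using L div_mult_self1[of "int L" "j - 1" k] by (simp add: algebra_simps)
  show ?thesis
  proof (rule bij_betwI[where g = ?cut])
    show "wrap L \<in> {R \<in> periodic_ncrel L. \<forall>i j. i \<le> 0 \<and> 0 < j \<longrightarrow> \<not> R i j} \<rightarrow> cyclic_ncrel L L"
      by (intro Pi_I wrap_in_cyclic_ncrel) auto
  next
    show "?cut \<in> cyclic_ncrel L L \<rightarrow> {R \<in> periodic_ncrel L. \<forall>i j. i \<le> 0 \<and> 0 < j \<longrightarrow> \<not> R i j}"
    proof
      fix E assume E: "E \<in> cyclic_ncrel L L"
      have eq: "equivp E" and shift: "\<And>i j. E (i + int L) (j + int L) = E i j"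
        and nc: "\<And>a b c e. a < b \<Longrightarrow> b < c \<Longrightarrow> c < e \<Longrightarrow> e < a + int L \<Longrightarrow> E a c \<Longrightarrow> E b e \<Longrightarrow> E a b"
        using E unfolding cyclic_ncrel_def by blast+
      have "equivp (?cut E)"
        using eq unfolding equivp_def by metis
      moreover have "noncrossing (?cut E)"
        unfolding noncrossing_def
      proof (intro allI impI)
        fix a b c e assume *: "a < b \<and> b < c \<and> c < e \<and> ?cut E a c \<and> ?cut E b e"
        have "(a - 1) div int L \<le> (b - 1) div int L" "(b - 1) div int L \<le> (c - 1) div int L"
          using L * by (intro zdiv_mono1; simp)+
        hence d: "(a - 1) div int L = (b - 1) div int L" "(a - 1) div int L = (e - 1) div int L"
          using * by auto
        have "(e - 1) < (a - 1) + int L"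
          using div_mult_mod_eq[of "e - 1" "int L"] div_mult_mod_eq[of "a - 1" "int L", unfolded d(2)]
            pos_mod_bound[OF L, of "e - 1"] pos_mod_sign[OF L, of "a - 1"] by linarith
        thus "?cut E a b" using nc[of a b c e] * d by simp
      qed
      moreover have "?cut E (i + int L) (j + int L) = ?cut E i j" for i j
        using shift div_shift[of i 1] div_shift[of j 1] by simp
      moreover have "\<not> ?cut E i j" if "i \<le> 0" "0 < j" for i j
      proof -
        have "(i - 1) div int L < 0" "0 \<le> (j - 1) div int L"
          using that L by (simp_all add: div_neg_pos_less0 pos_imp_zdiv_nonneg_iff)
        thus ?thesis by simp
      qed
      ultimately show "?cut E \<in> {R \<in> periodic_ncrel L. \<forall>i j. i \<le> 0 \<and> 0 < j \<longrightarrow> \<not> R i j}"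
        unfolding periodic_ncrel_def by blast
    qed
  next
    fix R assume R: "R \<in> {R \<in> periodic_ncrel L. \<forall>i j. i \<le> 0 \<and> 0 < j \<longrightarrow> \<not> R i j}"
    hence R1: "R \<in> periodic_ncrel L" and R2: "\<And>i j. i \<le> 0 \<Longrightarrow> 0 < j \<Longrightarrow> \<not> R i j" by auto
    have eq: "equivp R" using R1 by (simp add: periodic_ncrel_def)
    \<comment> \<open>A related pair in different windows could be translated so that it straddles
      the gap between 0 and 1, which \<open>R2\<close> forbids. With symmetry of \<open>R\<close>
      this gives both inequalities.\<close>
    have less: "(j - 1) div int L \<le> (i - 1) div int L" if "R i j" for i j
    proof (rule ccontr)
      assume "\<not> ?thesis"
      hence lt: "(i - 1) div int L < (j - 1) div int L" by simp
      define k where "k = (j - 1) div int L"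
      have "R (i + (- k) * int L) (j + (- k) * int L)"
        using that periodic_ncrel_shift[OF R1] by blast
      moreover have "i + (- k) * int L \<le> 0"
      proof (rule ccontr)
        assume "\<not> ?thesis"
        hence "0 \<le> (i + (- k) * int L - 1) div int L"
          using L by (simp add: pos_imp_zdiv_nonneg_iff)
        thus False using lt div_shift[of i "- k"] by (simp add: k_def)
      qed
      moreover have "0 < j + (- k) * int L"
      proof (rule ccontr)
        assume "\<not> ?thesis"
        hence "(j + (- k) * int L - 1) div int L < 0"
          using L by (intro div_neg_pos_less0) auto
        thus False using div_shift[of j "- k"] by (simp add: k_def)
      qed
      ultimately show False using R2 by blast
    qed
    have same: "(i - 1) div int L = (j - 1) div int L" if "R i j" for i j
      using less[OF that] less[OF equivp_symp[OF eq that]] by (rule order_antisym[rotated])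
    have "?cut (wrap L R) i j = R i j" for i j
    proof
      assume c: "?cut (wrap L R) i j"
      then obtain k where k: "R i (j + k * int L)" by (auto simp: wrap_def)
      have "k = 0" using same[OF k] c div_shift[of j k] by simp
      thus "R i j" using k by simp
    next
      assume "R i j"
      moreover from this have "wrap L R i j" unfolding wrap_def by (intro exI[of _ 0]) simp
      ultimately show "?cut (wrap L R) i j" using same by blast
    qed
    thus "?cut (wrap L R) = R" by blast
  next
    fix E assume E: "E \<in> cyclic_ncrel L L"
    have eq: "equivp E" and per: "\<And>i. E i (i + int L)"
      using E unfolding cyclic_ncrel_def by blast+
    have per': "E i (i + k * int L)" for i k
    proof -
      have "E i (i + k * int L) = E i i"
      proof (rule int_periodic[of "E i"])
        show "E i (t + int L) = E i t" for t
          using per[of t] eq by (meson equivp_symp equivp_transp)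
      qed
      thus ?thesis using eq by (simp add: equivp_reflp)
    qed
    have "wrap L (?cut E) i j = E i j" for i j
    proof
      assume "wrap L (?cut E) i j"
      then obtain k where "E i (j + k * int L)" by (auto simp: wrap_def)
      thus "E i j" using per'[of j k] eq by (meson equivp_symp equivp_transp)
    next
      assume "E i j"
      define k where "k = (i - 1) div int L - (j - 1) div int L"
      have "E i (j + k * int L)" using \<open>E i j\<close> per' eq by (meson equivp_transp)
      hence "?cut E i (j + k * int L)" using div_shift[of j k] by (simp add: k_def)
      thus "wrap L (?cut E) i j" unfolding wrap_def by blast
    qed
    thus "wrap L (?cut E) = E" by blast
  qed
qed

section \<open>Unrolling for a proper divisor\<close>

lemma unwrap_in_periodic_ncrel:
  assumes E: "E \<in> cyclic_ncrel L d" and d: "d \<ge> 1" "2 * d \<le> L"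
  shows "unwrap d E \<in> periodic_ncrel d"
proof -
  have eq: "equivp E" and shift: "\<And>i j. E (i + int d) (j + int d) = E i j"
    and nc: "\<And>a b c e. a < b \<Longrightarrow> b < c \<Longrightarrow> c < e \<Longrightarrow> e < a + int L \<Longrightarrow> E a c \<Longrightarrow> E b e \<Longrightarrow> E a b"
    using E unfolding cyclic_ncrel_def by blast+
  have refl: "E i i" and sym: "E i j \<Longrightarrow> E j i" and trans: "E i j \<Longrightarrow> E j k \<Longrightarrow> E i k" for i j k
    using eq by (meson equivp_reflp equivp_symp equivp_transp)+
  have dL: "2 * int d \<le> int L" "int d \<ge> 1" using d by auto
  have per: "E j (j + int d)" if "E i j" "E i (i + int d)" for i j
    using that shift[of i j] sym trans by blast
  \<comment> \<open>This makes the distance bound in \<open>unwrap\<close> transitive: if two short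
    links together span more than \<open>d\<close>, then the link from \<open>j\<close> to
    \<open>k\<close> interlaces with the translate by \<open>d\<close> of the link from
    \<open>i\<close> to \<open>j\<close>, and the class is invariant.\<close>
  have long: "E i (i + int d)"
    if "i < j" "j < k" "j - i < int d" "k - j < int d" "i + int d \<le> k" "E i j" "E j k" for i j k
  proof (cases "k = i + int d")
    case True
    thus ?thesis using that trans by blast
  next
    case False
    have "E j (i + int d)"
      by (rule nc[of j "i + int d" k "j + int d"]) (use that False dL shift in auto)
    thus ?thesis using that trans by blast
  qed
  have "equivp (unwrap d E)"
  proof (rule equivpI)
    show "reflp (unwrap d E)" using d refl by (simp add: reflp_def unwrap_def)
    show "symp (unwrap d E)"
      unfolding symp_def unwrap_def using sym per by (metis abs_minus_commute)
    show "transp (unwrap d E)"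
    proof (rule transpI)
      fix i j k assume ij: "unwrap d E i j" and jk: "unwrap d E j k"
      hence E: "E i j" "E j k" "E i k" using trans by (auto simp: unwrap_def)
      have "\<bar>i - k\<bar> < int d \<or> E i (i + int d)"
      proof (rule ccontr)
        assume *: "\<not> ?thesis"
        hence np: "\<not> E j (j + int d)" "\<not> E k (k + int d)"
          using per[of j i] per[of k i] E sym by blast+
        have "\<bar>i - j\<bar> < int d" "\<bar>j - k\<bar> < int d"
          using ij jk * np by (auto simp: unwrap_def)
        thus False
          using long[of i j k] long[of k j i] E sym * np by (smt (verit))
      qed
      thus "unwrap d E i k" using E by (simp add: unwrap_def)
    qed
  qed
  moreover have "noncrossing (unwrap d E)"
    unfolding noncrossing_def
  proof (intro allI impI)
    fix a b c e assume *: "a < b \<and> b < c \<and> c < e \<and> unwrap d E a c \<and> unwrap d E b e"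
    hence o: "a < b" "b < c" "c < e" and ac: "E a c" and be: "E b e" by (auto simp: unwrap_def)
    consider "E a (a + int d)" "E b (b + int d)" | "E a (a + int d)" "\<bar>b - e\<bar> < int d"
      | "\<bar>a - c\<bar> < int d" "E b (b + int d)" | "\<bar>a - c\<bar> < int d" "\<bar>b - e\<bar> < int d"
      using * unfolding unwrap_def by blast
    thus "unwrap d E a b"
    proof cases
      case 1
      have multiple: "E a (a + k * int d)" for k
      proof -
        have "E a (a + k * int d) = E a a"
        proof (rule int_periodic[of "E a"])
          show "E a (t + int d) = E a t" for t
            using per[of a t] per[of a "t + int d"] 1 shift[of t "a"] sym trans by metis
        qed
        thus ?thesis using refl by simp
      qed
      \<comment> \<open>Both classes are invariant under translation by \<open>d\<close>. The
        translate \<open>x\<close> of \<open>a\<close> is the last one not beyond \<open>b\<close>,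
        so \<open>x < b < x + d < b + d\<close> interlace within one turn unless
        \<open>x = b\<close>.\<close>
      define x where "x = a + ((b - a) div int d) * int d"
      have x: "E a x" using multiple by (simp add: x_def)
      have "b - x = (b - a) mod int d"
        using div_mult_mod_eq[of "b - a" "int d"] by (simp add: x_def algebra_simps)
      hence r: "x \<le> b" "b < x + int d"
        using dL pos_mod_bound[of "int d" "b - a"] pos_mod_sign[of "int d" "b - a"] by linarith+
      have "E a b"
      proof (cases "x = b")
        case False
        have "E x b"
          by (rule nc[of x b "x + int d" "b + int d"]) (use r False dL 1 per[OF x] in auto)
        thus ?thesis using x trans by blast
      qed (use x in simp)
      thus ?thesis using 1 by (simp add: unwrap_def)
    next
      case 2
      \<comment> \<open>The invariant class offers the chord from \<open>c - d\<close> to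
        \<open>c\<close> in place of the possibly long one from \<open>a\<close> to
        \<open>c\<close>; it still interlaces with the short chord from \<open>b\<close> to
        \<open>e\<close>.\<close>
      have cd: "E (c - int d) c" using per[OF ac] 2 shift[of "c - int d" c] by simp
      have "E (c - int d) b"
        by (rule nc[of "c - int d" b c e]) (use o 2 dL cd be in auto)
      hence "E a b" using cd ac sym trans by blast
      thus ?thesis using 2 by (simp add: unwrap_def)
    next
      case 3
      have "E a b"
        by (rule nc[of a b c "b + int d"]) (use o 3 dL ac in auto)
      thus ?thesis using 3 o by (simp add: unwrap_def)
    next
      case 4
      have "E a b"
        by (rule nc[of a b c e]) (use o 4 dL ac be in auto)
      thus ?thesis using 4 o by (simp add: unwrap_def)
    qed
  qed
  moreover have "unwrap d E (i + int d) (j + int d) = unwrap d E i j" for i j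
    unfolding unwrap_def shift by simp
  ultimately show ?thesis unfolding periodic_ncrel_def by blast
qed

lemma wrap_unwrap:
  assumes E: "E \<in> cyclic_ncrel L d" and d: "d \<ge> 1" "2 * d \<le> L"
  shows "wrap L (unwrap d E) = E"
proof -
  have eq: "equivp E" and collapse: "\<And>i. E i (i + int L)"
    and shift: "\<And>i j. E (i + int d) (j + int d) = E i j"
    and nc: "\<And>a b c e. a < b \<Longrightarrow> b < c \<Longrightarrow> c < e \<Longrightarrow> e < a + int L \<Longrightarrow> E a c \<Longrightarrow> E b e \<Longrightarrow> E a b"
    using E unfolding cyclic_ncrel_def by blast+
  have refl: "E i i" and sym: "E i j \<Longrightarrow> E j i" and trans: "E i j \<Longrightarrow> E j k \<Longrightarrow> E i k" for i j k
    using eq by (meson equivp_reflp equivp_symp equivp_transp)+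
  have dL: "2 * int d \<le> int L" "int d \<ge> 1" using d by auto
  have multiple: "E i (i + k * int L)" for i k
  proof -
    have "E i (i + k * int L) = E i i"
    proof (rule int_periodic[of "E i"])
      show "E i (t + int L) = E i t" for t using collapse[of t] sym trans by blast
    qed
    thus ?thesis using refl by simp
  qed
  have "wrap L (unwrap d E) i j = E i j" for i j
  proof
    assume "wrap L (unwrap d E) i j"
    then obtain k where "E i (j + k * int L)" by (auto simp: wrap_def unwrap_def)
    thus "E i j" using multiple[of j k] sym trans by blast
  next
    assume "E i j"
    define k where "k = - ((j - i) div int L)"
    \<comment> \<open>The translate of \<open>j\<close> in the window of length \<open>L\<close>
      that starts at \<open>i\<close>. It is close to \<open>i\<close>, or close to the translate of
      \<open>i\<close> at the end of the window, or else the class of \<open>i\<close> is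
      invariant.\<close>
    define l where "l = j + k * int L"
    have "l - i = (j - i) mod int L"
      using div_mult_mod_eq[of "j - i" "int L"] by (simp add: l_def k_def algebra_simps)
    hence l: "i \<le> l" "l < i + int L"
      using dL pos_mod_bound[of "int L" "j - i"] pos_mod_sign[of "int L" "j - i"] by linarith+
    have il: "E i l" using \<open>E i j\<close> multiple trans unfolding l_def by blast
    consider "l < i + int d" | "l > i + int L - int d" | "l = i + int d" | "l = i + int L - int d"
      | "i + int d < l" "l < i + int L - int d" by linarith
    thus "wrap L (unwrap d E) i j"
    proof cases
      case 1
      hence "unwrap d E i (j + k * int L)" using il l by (simp add: unwrap_def l_def)
      thus ?thesis unfolding wrap_def by blast
    next
      case 2
      have "E (l - int L) l" using collapse[of "l - int L"] by simp
      hence "E i (l - int L)" using il sym trans by blast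
      hence "unwrap d E i (l - int L)" using 2 l by (simp add: unwrap_def)
      moreover have "l - int L = j + (k - 1) * int L" by (simp add: l_def algebra_simps)
      ultimately show ?thesis unfolding wrap_def by metis
    next
      case 3
      hence "unwrap d E i (j + k * int L)" using il by (simp add: unwrap_def l_def)
      thus ?thesis unfolding wrap_def by blast
    next
      case 4
      hence "E (i + int d) (i + int L)" using shift[of i l] il by simp
      hence "E i (i + int d)" using collapse[of i] sym trans by blast
      hence "unwrap d E i (j + k * int L)" using il by (simp add: unwrap_def l_def)
      thus ?thesis unfolding wrap_def by blast
    next
      case 5
      \<comment> \<open>The chord from \<open>i\<close> to \<open>l\<close> interlaces with its own
        translate by \<open>d\<close>, and both lie within one turn.\<close>
      have "E i (i + int d)"
        by (rule nc[of i "i + int d" l "l + int d"]) (use 5 dL il shift in auto)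
      hence "unwrap d E i (j + k * int L)" using il by (simp add: unwrap_def l_def)
      thus ?thesis unfolding wrap_def by blast
    qed
  qed
  thus ?thesis by blast
qed

text \<open>In \<open>R\<close> itself, related points at distance at least \<open>d\<close> force
  invariance, since the pair interlaces with its translate by \<open>d\<close> (\<open>far\<close>).
  All other classes are shorter than \<open>d\<close>, hence than half a turn, so wrapping cannot
  link two different lifts of a point to them.\<close>

lemma unwrap_wrap:
  assumes R: "R \<in> periodic_ncrel d" and d: "d \<ge> 1" "d dvd L" "d < L"
  shows "unwrap d (wrap L R) = R"
proof -
  have eq: "equivp R" and nc: "noncrossing R" and shift: "\<And>i j. R (i + int d) (j + int d) = R i j"
    using R by (auto simp: periodic_ncrel_def)
  have refl: "R i i" and sym: "R i j \<Longrightarrow> R j i" and trans: "R i j \<Longrightarrow> R j k \<Longrightarrow> R i k" for i j k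
    using eq by (meson equivp_reflp equivp_symp equivp_transp)+
  obtain m where m: "L = d * m" using d(2) by blast
  have "m \<ge> 2"
  proof (rule ccontr)
    assume "\<not> m \<ge> 2"
    hence "m = 0 \<or> m = 1" by auto
    thus False using m d by auto
  qed
  hence "d * 2 \<le> d * m" by (rule mult_le_mono2)
  hence dL: "2 * int d \<le> int L" "int d \<ge> 1" using d m by linarith+
  have far': "R i (i + int d)" if "R i j" "i + int d \<le> j" for i j
  proof (cases "j = i + int d")
    case False
    thus ?thesis
      using nc[unfolded noncrossing_def, rule_format, of i "i + int d" j "j + int d"] that dL shift
      by auto
  qed (use that in simp)
  have far: "R i (i + int d)" if "R i j" "int d \<le> \<bar>i - j\<bar>" for i j
  proof (cases "i \<le> j")
    case False
    hence "R j (j + int d)" using far'[of j i] that sym by simp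
    thus ?thesis using that shift[of j i] sym trans by blast
  qed (use far' that in auto)
  have wrap_step: "R i (i + int d)" if "wrap L R i (i + int d)" for i
  proof -
    obtain k where k: "R i (i + int d + k * int L)" using \<open>wrap L R i (i + int d)\<close> by (auto simp: wrap_def)
    \<comment> \<open>Any lift of the pair \<open>i\<close>, \<open>i + d\<close> spans
      \<open>d * (1 + k * m)\<close>, which is nonzero because \<open>m\<close> is at least 2; so it
      spans at least \<open>d\<close> and \<open>far\<close> applies. For \<open>m = 1\<close> and
      \<open>k = - 1\<close> the span would vanish.\<close>
    have "1 + k * int m \<noteq> 0"
    proof
      assume "1 + k * int m = 0"
      hence "int m dvd 1" by (metis add.inverse_unique dvd_minus_iff dvd_triv_right)
      thus False using \<open>m \<ge> 2\<close> by simp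
    qed
    hence "int d * 1 \<le> int d * \<bar>1 + k * int m\<bar>" by (intro mult_left_mono) auto
    also have "int d * \<bar>1 + k * int m\<bar> = \<bar>int d * (1 + k * int m)\<bar>" by (simp add: abs_mult)
    also have "int d * (1 + k * int m) = int d + k * int L" by (simp add: m algebra_simps)
    finally show ?thesis using far[OF k] by simp
  qed
  have whole: "R i j" if "R i (i + int d)" "R i (j + k * int L)" for i j k
  proof -
    let ?x = "j + k * int L"
    have "R ?x (?x + int d)" using that shift[of i ?x] sym trans by blast
    moreover have x: "?x = j + (k * int m) * int d" by (simp add: m)
    ultimately have j: "R j (j + int d)"
      using periodic_ncrel_shift[OF R, of j "k * int m" "j + int d"] by (simp add: add_ac)
    have "R j (j + (k * int m) * int d) = R j j"
    proof (rule int_periodic[of "R j"])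
      show "R j (t + int d) = R j t" for t
        using shift[of j t] j sym trans by blast
    qed
    hence "R j ?x" using refl unfolding x by simp
    thus ?thesis using that sym trans by blast
  qed
  have "unwrap d (wrap L R) i j = R i j" for i j
  proof
    assume u: "unwrap d (wrap L R) i j"
    then obtain k where k: "R i (j + k * int L)" by (auto simp: unwrap_def wrap_def)
    show "R i j"
    proof (cases "R i (i + int d)")
      case True
      thus ?thesis using whole k by blast
    next
      case False
      hence "\<bar>i - j\<bar> < int d" using u wrap_step by (auto simp: unwrap_def)
      moreover have "\<bar>i - (j + k * int L)\<bar> < int d" using far[OF k] False by linarith
      \<comment> \<open>Two positions closer than \<open>d\<close> to \<open>i\<close> differ by
        less than \<open>2 * d\<close>, hence by less than one turn.\<close>
      ultimately have "\<bar>k * int L\<bar> < int L" using dL by linarith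
      hence "\<bar>k\<bar> * int L < 1 * int L" by (simp add: abs_mult)
      hence "k = 0" using mult_less_cancel_right_pos[of "int L"] dL by simp
      thus ?thesis using k by simp
    qed
  next
    assume "R i j"
    have sub: "wrap L R i j" if "R i j" for i j
      unfolding wrap_def by (rule exI[of _ 0]) (use that in simp)
    show "unwrap d (wrap L R) i j"
      using sub[OF \<open>R i j\<close>] far[OF \<open>R i j\<close>] sub[of i "i + int d"] unfolding unwrap_def by linarith
  qed
  thus ?thesis by blast
qed

lemma bij_betw_wrap:
  assumes "d \<ge> 1" "d dvd L" "d < L"
  shows "bij_betw (wrap L) (periodic_ncrel d) (cyclic_ncrel L d)"
proof -
  obtain m where m: "L = d * m" using assms(2) by blast
  hence "m \<ge> 2" using assms by (cases m) (auto intro: Suc_leI)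
  hence "d * 2 \<le> d * m" by (rule mult_le_mono2)
  hence "2 * d \<le> L" using m by simp
  thus ?thesis
    using assms
    by (intro bij_betwI[where g = "unwrap d"] Pi_I)
      (simp_all add: wrap_in_cyclic_ncrel unwrap_in_periodic_ncrel wrap_unwrap unwrap_wrap)
qed

section \<open>Noncrossing partitions as relations on the integers\<close>

definition rep :: "nat \<Rightarrow> int \<Rightarrow> nat" where
  "rep L i = nat ((i - 1) mod int L + 1)"

definition partition_rel :: "nat \<Rightarrow> nat set set \<Rightarrow> int \<Rightarrow> int \<Rightarrow> bool" where
  "partition_rel L P i j \<longleftrightarrow> (\<exists>A\<in>P. rep L i \<in> A \<and> rep L j \<in> A)"

text \<open>Powers of the rotation, with integer exponents so that inverses are shifts too, and
  extensional as \<open>BijGroup\<close> demands.\<close>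

definition shift_map :: "nat \<Rightarrow> int \<Rightarrow> nat \<Rightarrow> nat" where
  "shift_map L k = (\<lambda>x\<in>{1..L}. rep L (int x + k))"

lemma int_rep: "L \<ge> 1 \<Longrightarrow> int (rep L i) = (i - 1) mod int L + 1"
  by (simp add: rep_def)

lemma rep_range: "L \<ge> 1 \<Longrightarrow> rep L i \<in> {1..L}"
  using int_rep[of L i] pos_mod_bound[of "int L" "i - 1"] pos_mod_sign[of "int L" "i - 1"]
  unfolding atLeastAtMost_iff by linarith

lemma rep_eq: "1 \<le> i \<Longrightarrow> i \<le> int L \<Longrightarrow> rep L i = nat i"
  by (simp add: rep_def)

lemma rep_of_mem: "x \<in> {1..L} \<Longrightarrow> rep L (int x) = x"
  by (simp add: rep_eq)

lemma rep_shift: "rep L (i + k * int L) = rep L i"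
proof -
  have "(i + k * int L - 1) mod int L = (i - 1) mod int L"
    using mod_mult_self1[of "i - 1" k "int L"] by (simp add: algebra_simps)
  thus ?thesis by (simp add: rep_def)
qed

lemma rep_add:
  assumes "L \<ge> 1"
  shows "rep L (int (rep L i) + k) = rep L (i + k)"
proof -
  have "(int (rep L i) + k - 1) mod int L = ((i - 1) mod int L + k) mod int L"
    unfolding int_rep[OF assms] by (simp add: algebra_simps)
  also have "\<dots> = (i + k - 1) mod int L"
    unfolding mod_add_left_eq by (simp add: algebra_simps)
  finally show ?thesis by (simp add: rep_def)
qed

lemma noncrossing_partitionsD:
  assumes "P \<in> noncrossing_partitions L" "A \<in> P" "B \<in> P" "a < b" "b < c" "c < e"
    "a \<in> A" "c \<in> A" "b \<in> B" "e \<in> B"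
  shows "A = B"
  using assms unfolding noncrossing_partitions_def by blast

lemma partition_rel_in_cyclic_ncrel:
  assumes L: "L \<ge> 1" and P: "P \<in> noncrossing_partitions L"
  shows "partition_rel L P \<in> cyclic_ncrel L L"
proof -
  have part: "partition_on {1..L} P" using P by (simp add: noncrossing_partitions_def)
  have same: "A = B" if "A \<in> P" "B \<in> P" "x \<in> A" "x \<in> B" for A B x
    using part that unfolding partition_on_def disjoint_def by blast
  let ?R = "partition_rel L P"
  have "equivp ?R"
  proof (rule equivpI)
    show "reflp ?R"
    proof (rule reflpI)
      fix i
      have "rep L i \<in> \<Union>P" using rep_range[OF L] part by (simp add: partition_on_def)
      thus "?R i i" by (auto simp: partition_rel_def)
    qed
    show "symp ?R" by (auto simp: symp_def partition_rel_def)
    show "transp ?R"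
      unfolding transp_def partition_rel_def using same by blast
  qed
  moreover have per: "?R (i + k * int L) (j + k * int L) = ?R i j" for i j k
    by (simp add: partition_rel_def rep_shift)
  have cross1: "?R a b" if o: "1 \<le> a" "a \<le> int L" "a < b" "b < c" "c < e" "e < a + int L"
    and "?R a c" "?R b e" for a b c e
  proof -
    obtain A B where A: "A \<in> P" "rep L a \<in> A" "rep L c \<in> A" and B: "B \<in> P" "rep L b \<in> B" "rep L e \<in> B"
      using \<open>?R a c\<close> \<open>?R b e\<close> by (auto simp: partition_rel_def)
    have low: "rep L x = nat x" if "a \<le> x" "x \<le> int L" for x
      using that o by (intro rep_eq) auto
    have high: "rep L x = nat (x - int L)" if "int L < x" "x < a + int L" for x
      using rep_shift[of L "x - int L" 1] rep_eq[of "x - int L" L] that o by simp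
    \<comment> \<open>The number of points beyond \<open>L\<close> decides how the four reduced
      points are rotated; if it is odd, \<open>A\<close> and \<open>B\<close> exchange their
      roles.\<close>
    consider "e \<le> int L" | "c \<le> int L" "int L < e" | "b \<le> int L" "int L < c" | "int L < b"
      by linarith
    hence "A = B"
    proof cases
      case 1
      show ?thesis
        by (rule noncrossing_partitionsD[OF P A(1) B(1), of "nat a" "nat b" "nat c" "nat e"])
          (use A B o 1 low in auto)
    next
      case 2
      have "B = A"
        by (rule noncrossing_partitionsD[OF P B(1) A(1), of "nat (e - int L)" "nat a" "nat b" "nat c"])
          (use A B o 2 low high in auto)
      thus ?thesis ..
    next
      case 3
      show ?thesis
        by (rule noncrossing_partitionsD[OF P A(1) B(1), of "nat (c - int L)" "nat (e - int L)" "nat a" "nat b"])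
          (use A B o 3 low high in auto)
    next
      case 4
      have "B = A"
        by (rule noncrossing_partitionsD[OF P B(1) A(1), of "nat (b - int L)" "nat (c - int L)" "nat (e - int L)" "nat a"])
          (use A B o 4 low high in auto)
      thus ?thesis ..
    qed
    thus ?thesis using A B by (auto simp: partition_rel_def)
  qed
  have "?R a b" if o: "a < b" "b < c" "c < e" "e < a + int L" and R: "?R a c" "?R b e" for a b c e
  proof -
    \<comment> \<open>A translation by a multiple of \<open>L\<close> brings \<open>a\<close> into
      {1..L}, the situation of \<open>cross1\<close>.\<close>
    obtain k where k: "(a - 1) mod int L + 1 = a + k * int L" by (rule mod_shift)
    have range: "1 \<le> a + k * int L" "a + k * int L \<le> int L"
      using rep_range[OF L, of a] int_rep[OF L, of a] k by auto
    have "?R (a + k * int L) (b + k * int L)"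
      by (rule cross1[OF range, of _ "c + k * int L" "e + k * int L"]) (use o R per in auto)
    thus ?thesis using per by simp
  qed
  moreover have "?R i (i + int L)" for i
    using equivp_reflp[OF \<open>equivp ?R\<close>, of i] rep_shift[of L i 1] by (simp add: partition_rel_def)
  moreover have "?R (i + int L) (j + int L) = ?R i j" for i j
    using per[of i 1 j] by simp
  ultimately show ?thesis unfolding cyclic_ncrel_def by blast
qed

lemma inj_on_partition_rel:
  assumes L: "L \<ge> 1"
  shows "inj_on (partition_rel L) (noncrossing_partitions L)"
proof (rule inj_onI)
  fix P Q assume P: "P \<in> noncrossing_partitions L" and Q: "Q \<in> noncrossing_partitions L"
    and eq: "partition_rel L P = partition_rel L Q"
  have block: "(\<exists>p\<in>S. x \<in> p \<and> y \<in> p) \<longleftrightarrow> x \<in> {1..L} \<and> y \<in> {1..L} \<and> partition_rel L S (int x) (int y)"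
    if "S \<in> noncrossing_partitions L" for S x y
  proof -
    have "x \<in> {1..L}" if "p \<in> S" "x \<in> p" for p x
      using block_subset[OF \<open>S \<in> _\<close> that(1)] that(2) by blast
    thus ?thesis unfolding partition_rel_def using rep_of_mem by metis
  qed
  have "{(x, y). \<exists>p\<in>P. x \<in> p \<and> y \<in> p} = {(x, y). \<exists>p\<in>Q. x \<in> p \<and> y \<in> p}"
    unfolding block[OF P] block[OF Q] eq ..
  moreover have "partition_on {1..L} P" "partition_on {1..L} Q"
    using P Q by (auto simp: noncrossing_partitions_def)
  ultimately show "P = Q"
    using partition_on_eq_quotient[of "{1..L}" P] partition_on_eq_quotient[of "{1..L}" Q] by simp
qed

lemma partition_rel_surj:
  assumes L: "L \<ge> 1" and E: "E \<in> cyclic_ncrel L L"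
  obtains P where "P \<in> noncrossing_partitions L" "partition_rel L P = E"
proof -
  have eq: "equivp E" and collapse: "\<And>i. E i (i + int L)"
    and nc: "\<And>a b c e. a < b \<Longrightarrow> b < c \<Longrightarrow> c < e \<Longrightarrow> e < a + int L \<Longrightarrow> E a c \<Longrightarrow> E b e \<Longrightarrow> E a b"
    using E unfolding cyclic_ncrel_def by blast+
  have refl: "E i i" and sym: "E i j \<Longrightarrow> E j i" and trans: "E i j \<Longrightarrow> E j k \<Longrightarrow> E i k" for i j k
    using eq by (meson equivp_reflp equivp_symp equivp_transp)+
  define r where "r = {(x, y). x \<in> {1..L} \<and> y \<in> {1..L} \<and> E (int x) (int y)}"
  define P where "P = {1..L} // r"
  have r: "equiv {1..L} r"
  proof (rule equivI)
    show "r \<subseteq> {1..L} \<times> {1..L}" by (auto simp: r_def)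
    show "refl_on {1..L} r" by (auto simp: refl_on_def r_def refl)
    show "Relation.sym r" by (auto simp: sym_def r_def sym)
    show "Relation.trans r" unfolding trans_def r_def using trans by blast
  qed
  have part: "partition_on {1..L} P"
    unfolding P_def by (rule partition_on_quotient[OF r])
  have block: "(\<exists>A\<in>P. x \<in> A \<and> y \<in> A) \<longleftrightarrow> (x, y) \<in> r" for x y
  proof
    assume "\<exists>A\<in>P. x \<in> A \<and> y \<in> A"
    thus "(x, y) \<in> r" unfolding P_def using quotient_eq_iff[OF r] by blast
  next
    assume xy: "(x, y) \<in> r"
    hence "x \<in> {1..L}" by (auto simp: r_def)
    hence "r `` {x} \<in> P" "x \<in> r `` {x}" "y \<in> r `` {x}"
      using xy equiv_class_self[OF r] unfolding P_def by (blast intro: quotientI)+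
    thus "\<exists>A\<in>P. x \<in> A \<and> y \<in> A" by blast
  qed
  have "A = B" if "A \<in> P" "B \<in> P" "a < b" "b < c" "c < e" "a \<in> A" "c \<in> A" "b \<in> B" "e \<in> B"
    for A B a b c e
  proof -
    have ac: "(a, c) \<in> r" and be: "(b, e) \<in> r" using that block by blast+
    hence "E (int a) (int b)"
      using that nc[of "int a" "int b" "int c" "int e"] by (auto simp: r_def)
    hence "(a, b) \<in> r" using ac be by (auto simp: r_def)
    thus ?thesis using quotient_eq_iff[OF r] that unfolding P_def by blast
  qed
  hence P: "P \<in> noncrossing_partitions L"
    using part unfolding noncrossing_partitions_def by blast
  have E_rep: "E i (int (rep L i))" for i
  proof -
    obtain k where k: "(i - 1) mod int L + 1 = i + k * int L" by (rule mod_shift)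
    have "E i (i + k * int L) = E i i"
    proof (rule int_periodic[of "E i"])
      show "E i (t + int L) = E i t" for t using collapse[of t] sym trans by blast
    qed
    thus ?thesis using refl k int_rep[OF L, of i] by simp
  qed
  have "partition_rel L P i j = E i j" for i j
  proof -
    have "partition_rel L P i j \<longleftrightarrow> E (int (rep L i)) (int (rep L j))"
      using rep_range[OF L] block by (simp add: partition_rel_def r_def)
    thus ?thesis using E_rep sym trans by blast
  qed
  hence "partition_rel L P = E" by blast
  thus ?thesis using that P by blast
qed

section \<open>Rotations as shifts of the integers\<close>

lemma shift_map_rep: "L \<ge> 1 \<Longrightarrow> shift_map L k (rep L i) = rep L (i + k)"
  using rep_range[of L i] rep_add[of L i k] by (simp add: shift_map_def del: atLeastAtMost_iff)

lemma shift_map_compose: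
  assumes "L \<ge> 1"
  shows "compose {1..L} (shift_map L a) (shift_map L b) = shift_map L (b + a)"
proof
  fix x
  show "compose {1..L} (shift_map L a) (shift_map L b) x = shift_map L (b + a) x"
  proof (cases "x \<in> {1..L}")
    case True
    hence "shift_map L b x = rep L (int x + b)" "shift_map L (b + a) x = rep L (int x + b + a)"
      by (simp_all add: shift_map_def add.assoc)
    thus ?thesis using True shift_map_rep[OF assms] by (simp add: compose_def del: atLeastAtMost_iff)
  qed (simp add: compose_def shift_map_def del: atLeastAtMost_iff)
qed

lemma shift_map_0: "shift_map L 0 = (\<lambda>x\<in>{1..L}. x)"
  unfolding shift_map_def by (rule restrict_ext) (use rep_of_mem in simp)

lemma shift_map_1: "L \<ge> 1 \<Longrightarrow> shift_map L 1 = rotation L"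
  unfolding shift_map_def rotation_def
proof (rule restrict_ext)
  fix x assume "L \<ge> 1" "x \<in> {1..L}"
  have "int (rep L (int x + 1)) = int (x mod L + 1)"
    unfolding int_rep[OF \<open>L \<ge> 1\<close>] by (simp add: zmod_int)
  thus "rep L (int x + 1) = x mod L + 1" by linarith
qed

lemma shift_map_shift: "shift_map L (k + m * int L) = shift_map L k"
  unfolding shift_map_def
  by (rule restrict_ext) (use rep_shift[of L "int x + k" m for x] in \<open>simp add: add.assoc\<close>)

lemma shift_map_in_Bij:
  assumes "L \<ge> 1"
  shows "shift_map L k \<in> Bij {1..L}"
proof -
  have inv: "shift_map L a (shift_map L b x) = x" if "x \<in> {1..L}" "b + a = 0" for a b x
  proof -
    have "shift_map L b x = rep L (int x + b)" using that(1) by (simp add: shift_map_def)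
    hence "shift_map L a (shift_map L b x) = rep L (int x + b + a)"
      using shift_map_rep[OF assms] by simp
    thus ?thesis using that rep_of_mem by (simp add: add.assoc)
  qed
  have maps: "shift_map L a x \<in> {1..L}" if "x \<in> {1..L}" for a x
    using that rep_range[OF assms] by (simp add: shift_map_def del: atLeastAtMost_iff)
  have "bij_betw (shift_map L k) {1..L} {1..L}"
    by (rule bij_betwI[where g = "shift_map L (- k)"]) (use inv maps in auto)
  thus ?thesis by (auto simp: Bij_def shift_map_def)
qed

text \<open>The lift of the rotated partition is the translate by \<open>k\<close> of the lift of
  \<open>P\<close>, and a noncrossing partition is determined by its lift.\<close>

lemma shift_map_fixes_iff:
  assumes L: "L \<ge> 1" and P: "P \<in> noncrossing_partitions L"
    and Q: "(\<lambda>A. shift_map L k ` A) ` P \<in> noncrossing_partitions L"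
  shows "(\<lambda>A. shift_map L k ` A) ` P = P \<longleftrightarrow>
    (\<forall>i j. partition_rel L P (i + k) (j + k) = partition_rel L P i j)"
proof -
  let ?Q = "(\<lambda>A. shift_map L k ` A) ` P"
  have inj: "inj_on (shift_map L k) {1..L}"
    using shift_map_in_Bij[OF L, of k] by (auto simp: Bij_def bij_betw_def)
  have mem: "rep L (i + k) \<in> shift_map L k ` A \<longleftrightarrow> rep L i \<in> A" if "A \<in> P" for A i
    using inj_on_image_mem_iff[OF inj rep_range[OF L] block_subset[OF P that]] shift_map_rep[OF L]
    by metis
  have moved: "partition_rel L ?Q (i + k) (j + k) = partition_rel L P i j" for i j
    using mem by (simp add: partition_rel_def)
  have "?Q = P \<longleftrightarrow> partition_rel L ?Q = partition_rel L P"
    using inj_on_eq_iff[OF inj_on_partition_rel[OF L] Q P] by simp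
  also have "\<dots> \<longleftrightarrow> (\<forall>i j. partition_rel L ?Q (i + k) (j + k) = partition_rel L P (i + k) (j + k))"
  proof
    assume *: "\<forall>i j. partition_rel L ?Q (i + k) (j + k) = partition_rel L P (i + k) (j + k)"
    have "partition_rel L ?Q i j = partition_rel L P i j" for i j
      using *[rule_format, of "i - k" "j - k"] by simp
    thus "partition_rel L ?Q = partition_rel L P" by blast
  qed simp
  finally show ?thesis unfolding moved by metis
qed

section \<open>Orbit counting\<close>

text \<open>The exponents run over {0<..L}, with the identity at \<open>L\<close>, to match the
  range over which \<open>card_gcd_eq_totient\<close> counts.\<close>

lemma carrier_rotation_group:
  assumes L: "L \<ge> 1"
  shows "carrier (rotation_group L) = (\<lambda>k. shift_map L (int k)) ` {0<..L}"
proof -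
  let ?B = "BijGroup {1..L}"
  interpret B: group ?B by (rule group_BijGroup)
  have Bij: "shift_map L k \<in> Bij {1..L}" for k by (rule shift_map_in_Bij[OF L])
  have mult: "shift_map L a \<otimes>\<^bsub>?B\<^esub> shift_map L b = shift_map L (b + a)" for a b
    using Bij shift_map_compose[OF L] by (simp add: BijGroup_def)
  have one: "\<one>\<^bsub>?B\<^esub> = shift_map L 0" by (simp add: BijGroup_def shift_map_0)
  have carr: "carrier ?B = Bij {1..L}" by (simp add: BijGroup_def)
  have gen: "carrier (rotation_group L) = generate ?B {shift_map L 1}"
  proof -
    have "carrier ?B \<inter> {shift_map L 1} = {shift_map L 1}" unfolding carr using Bij by blast
    thus ?thesis
      by (simp only: rotation_group_def carrier_subgroup_generated shift_map_1[OF L])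
  qed
  have "generate ?B {shift_map L 1} = range (shift_map L)"
  proof
    show "generate ?B {shift_map L 1} \<subseteq> range (shift_map L)"
    proof
      fix g assume "g \<in> generate ?B {shift_map L 1}"
      thus "g \<in> range (shift_map L)"
      proof (induction rule: generate.induct)
        case (inv h)
        have "inv\<^bsub>?B\<^esub> (shift_map L 1) = shift_map L (- 1)"
          by (rule B.inv_equality) (use mult one carr Bij in simp_all)
        thus ?case using inv by auto
      next
        case (eng g h)
        thus ?case using mult by auto
      qed (use one in auto)
    qed
  next
    have "shift_map L (int n) \<in> generate ?B {shift_map L 1}" for n
    proof (induction n)
      case 0
      show ?case using generate.one[of ?B] one by simp
    next
      case (Suc n)
      have "shift_map L 1 \<otimes>\<^bsub>?B\<^esub> shift_map L (int n) \<in> generate ?B {shift_map L 1}"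
        by (rule generate.eng[OF generate.incl Suc]) simp
      thus ?case unfolding mult by (simp add: add.commute)
    qed
    moreover have "shift_map L k = shift_map L (int (nat (k mod int L)))" for k
      using shift_map_shift[of L "k mod int L" "k div int L"] L by simp
    ultimately show "range (shift_map L) \<subseteq> generate ?B {shift_map L 1}" by (metis image_subsetI)
  qed
  also have "range (shift_map L) = (\<lambda>k. shift_map L (int k)) ` {0<..L}"
  proof
    show "range (shift_map L) \<subseteq> (\<lambda>k. shift_map L (int k)) ` {0<..L}"
    proof
      fix g assume "g \<in> range (shift_map L)"
      then obtain k where k: "g = shift_map L k" by blast
      obtain m where m: "(k - 1) mod int L + 1 = k + m * int L" by (rule mod_shift)
      have "g = shift_map L (int (rep L k))"
        unfolding int_rep[OF L] m shift_map_shift k ..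
      moreover have "rep L k \<in> {0<..L}" using rep_range[OF L, of k] by auto
      ultimately show "g \<in> (\<lambda>k. shift_map L (int k)) ` {0<..L}" by blast
    qed
  qed auto
  finally show ?thesis using gen by simp
qed

lemma inj_on_shift_map: "L \<ge> 1 \<Longrightarrow> inj_on (\<lambda>k. shift_map L (int k)) {0<..L}"
proof (rule inj_onI)
  fix j k assume L: "L \<ge> 1" and jk: "j \<in> {0<..L}" "k \<in> {0<..L}"
    and eq: "shift_map L (int j) = shift_map L (int k)"
  have "rep L (0 + int j) = rep L (0 + int k)"
    using eq shift_map_rep[OF L, of _ 0] by metis
  moreover have "rep L (int j) = j" "rep L (int k) = k"
    using jk by (auto intro!: rep_of_mem)
  ultimately show "j = k" by simp
qed

text \<open>The translations that leave a relation invariant form a subgroup of the integers. It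
  contains \<open>L\<close> because every point is related to its translate by \<open>L\<close>;
  Bezout turns \<open>k\<close> and \<open>L\<close> into their gcd.\<close>

lemma cyclic_ncrel_gcd:
  assumes "L \<ge> 1"
  shows "cyclic_ncrel L k = cyclic_ncrel L (gcd k L)"
proof -
  have "(\<forall>i j. E (i + int k) (j + int k) = E i j) \<longleftrightarrow>
      (\<forall>i j. E (i + int (gcd k L)) (j + int (gcd k L)) = E i j)"
    if eq: "equivp E" and collapse: "\<And>i. E i (i + int L)" for E
  proof -
    have mult: "E (i + m * s) (j + m * s) = E i j"
      if "\<forall>i j. E (i + s) (j + s) = E i j" for s m i j
    proof -
      have "(\<lambda>t. E (i + t) (j + t)) (0 + m * s) = (\<lambda>t. E (i + t) (j + t)) 0"
        by (rule int_periodic) (use that in \<open>simp add: add.assoc[symmetric]\<close>)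
      thus ?thesis by simp
    qed
    have invL: "\<forall>i j. E (i + int L) (j + int L) = E i j"
      using collapse eq by (meson equivp_symp equivp_transp)
    show ?thesis
    proof
      assume invk: "\<forall>i j. E (i + int k) (j + int k) = E i j"
      obtain u v where uv: "u * int k + v * int L = gcd (int k) (int L)"
        using bezout_int by blast
      have g: "int (gcd k L) = u * int k + v * int L" by (simp add: uv gcd_int_int_eq)
      show "\<forall>i j. E (i + int (gcd k L)) (j + int (gcd k L)) = E i j"
        unfolding g add.assoc[symmetric] using mult[OF invk] mult[OF invL] by simp
    next
      assume inv: "\<forall>i j. E (i + int (gcd k L)) (j + int (gcd k L)) = E i j"
      obtain m where "k = gcd k L * m" by (meson dvdE gcd_dvd1)
      hence "int k = int m * int (gcd k L)" by (metis mult.commute of_nat_mult)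
      thus "\<forall>i j. E (i + int k) (j + int k) = E i j"
        using mult[OF inv, of _ "int m"] by simp
    qed
  qed
  thus ?thesis unfolding cyclic_ncrel_def by blast
qed

lemma card_invariants_shift_map:
  assumes L: "L \<ge> 1" and k: "k \<in> {0<..L}"
  shows "card (invariants (noncrossing_partitions L) (partition_action L) (shift_map L (int k))) =
    card (cyclic_ncrel L (gcd k L))"
proof -
  let ?g = "shift_map L (int k)"
  let ?I = "invariants (noncrossing_partitions L) (partition_action L) ?g"
  have "?g \<in> carrier (rotation_group L)" using carrier_rotation_group[OF L] k by blast
  hence pres: "(\<lambda>A. ?g ` A) ` P \<in> noncrossing_partitions L" if "P \<in> noncrossing_partitions L" for P
    using rotation_group_preserves(2) that by blast
  have I: "?I = {P \<in> noncrossing_partitions L. partition_rel L P \<in> cyclic_ncrel L k}"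
    unfolding invariants_def
  proof (rule Collect_cong, rule conj_cong)
    fix P assume P: "P \<in> noncrossing_partitions L"
    have "partition_action L ?g P = P \<longleftrightarrow> (\<lambda>A. ?g ` A) ` P = P"
      using P by (simp add: partition_action_def)
    also have "\<dots> \<longleftrightarrow> partition_rel L P \<in> cyclic_ncrel L k"
      unfolding shift_map_fixes_iff[OF L P pres[OF P]]
      using partition_rel_in_cyclic_ncrel[OF L P] unfolding cyclic_ncrel_def by blast
    finally show "partition_action L ?g P = P \<longleftrightarrow> partition_rel L P \<in> cyclic_ncrel L k" .
  qed simp
  have "E \<in> cyclic_ncrel L L" if "E \<in> cyclic_ncrel L k" for E
  proof -
    have eq: "equivp E" and collapse: "\<And>i. E i (i + int L)"
      using that unfolding cyclic_ncrel_def by blast+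
    have "E (i + int L) (j + int L) = E i j" for i j
      using collapse eq by (meson equivp_symp equivp_transp)
    thus ?thesis using that unfolding cyclic_ncrel_def by blast
  qed
  hence "cyclic_ncrel L k \<subseteq> partition_rel L ` ?I"
    unfolding I using partition_rel_surj[OF L] by (metis (mono_tags, lifting) imageI mem_Collect_eq subsetI)
  hence "partition_rel L ` ?I = cyclic_ncrel L k" unfolding I by blast
  moreover have "inj_on (partition_rel L) ?I"
    using inj_on_partition_rel[OF L] by (rule inj_on_subset) (auto simp: I)
  ultimately have "card ?I = card (cyclic_ncrel L k)"
    using card_image[of "partition_rel L" ?I] by (simp only:)
  thus ?thesis using cyclic_ncrel_gcd[OF L] by simp
qed

section \<open>Numbers of fixed partitions\<close>

lemma card_cyclic_ncrel:
  assumes "d \<ge> 1" "d dvd L" "d < L"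
  shows "card (cyclic_ncrel L d) = 2 * d choose d"
  using bij_betw_same_card[OF bij_betw_wrap[OF assms]]
    bij_betw_same_card[OF bij_betw_walk_rel[OF assms(1)]] card_walks[OF assms(1)] by simp

text \<open>Time 0 lies between the points 0 and 1. A relation across it would need an odd height
  that is at most 0, hence negative. Conversely a walk that becomes negative does so on both sides
  of time 0 by periodicity, and its nearest visits to -1 on the two sides are related
  points.\<close>

lemma walk_rel_cut_iff_nonneg:
  assumes h: "h \<in> walks d" and d: "d \<ge> 1"
  shows "(\<forall>i j. i \<le> 0 \<and> 0 < j \<longrightarrow> \<not> walk_rel h i j) \<longleftrightarrow> (\<forall>t. 0 \<le> h t)"
proof -
  have h0: "h 0 = 0" and step: "\<And>t. \<bar>h (t + 1) - h t\<bar> = 1"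
    and per: "\<And>t k. h (t + k * (2 * int d)) = h t"
    using h int_periodic[of h "2 * int d"] by (auto simp: walks_def)
  have par: "even (h t) = even t" for t
    by (rule walk_parity[OF h0 step])
  show ?thesis
  proof
    assume cut: "\<forall>i j. i \<le> 0 \<and> 0 < j \<longrightarrow> \<not> walk_rel h i j"
    show "\<forall>t. 0 \<le> h t"
    proof (rule ccontr)
      assume "\<not> ?thesis"
      then obtain s where "h s < 0" by (auto simp: not_le)
      hence s: "h s \<le> - 1" by simp
      \<comment> \<open>A negative time in the period to the right of 0;
        \<open>p - 2 * int d\<close> is its copy to the left.\<close>
      define p where "p = s mod (2 * int d)"
      have "h p = h s"
        using per[of p "s div (2 * int d)"] unfolding p_def mod_div_mult_eq by simp
      moreover have "0 \<le> p" "p < 2 * int d" using d by (simp_all add: p_def)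
      moreover have "p \<noteq> 0" using calculation(1) s h0 by auto
      ultimately have p: "0 < p" "p - 2 * int d < 0" "h p \<le> - 1" "h (p - 2 * int d) \<le> - 1"
        using s per[of p "- 1"] by auto
      obtain t where t: "0 < t" "h t = - 1" "\<And>s. 0 \<le> s \<Longrightarrow> s < t \<Longrightarrow> - 1 < h s"
        by (rule first_hit[of h "- 1" 0 p]) (use step h0 p in auto)
      obtain u where u: "u < 0" "h u = - 1" "\<And>s. u < s \<Longrightarrow> s \<le> 0 \<Longrightarrow> - 1 < h s"
        by (rule last_hit[of h "- 1" 0 "p - 2 * int d"]) (use step h0 p in auto)
      have "odd t" "odd u" using par[of t] par[of u] t(2) u(2) by auto
      then obtain i j where "t = 2 * j + 1" "u = 2 * i + 1" by (auto elim!: oddE)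
      hence ij: "t = 2 * (j + 1) - 1" "u = 2 * (i + 1) - 1" by auto
      have "- 1 \<le> h s" if "u \<le> s" "s \<le> t" for s
      proof (cases "s = u \<or> s = t")
        case False
        thus ?thesis using t(3)[of s] u(3)[of s] that by (cases "s \<le> 0") auto
      qed (use t(2) u(2) in auto)
      hence "walk_rel h (i + 1) (j + 1)"
        using t(1,2) u(1,2) unfolding ij by (intro walk_relI) auto
      moreover have "i + 1 \<le> 0" "0 < j + 1" using t(1) u(1) ij by auto
      ultimately show False using cut by blast
    qed
  next
    assume nonneg: "\<forall>t. 0 \<le> h t"
    show "\<forall>i j. i \<le> 0 \<and> 0 < j \<longrightarrow> \<not> walk_rel h i j"
    proof (intro allI impI notI)
      fix i j assume ij: "i \<le> 0 \<and> 0 < j" "walk_rel h i j"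
      have "h (2 * i - 1) \<le> h 0" using walk_relD(2)[OF ij(2), of 0] ij(1) by simp
      hence "h (2 * i - 1) = 0" using nonneg h0 by (simp add: order_antisym)
      thus False using par[of "2 * i - 1"] by simp
    qed
  qed
qed

lemma card_cyclic_ncrel_self:
  assumes L: "L \<ge> 1"
  shows "real (card (cyclic_ncrel L L)) = catalan L"
proof -
  let ?C = "{R \<in> periodic_ncrel L. \<forall>i j. i \<le> 0 \<and> 0 < j \<longrightarrow> \<not> R i j}"
  let ?W = "{h \<in> walks L. \<forall>t. 0 \<le> h t}"
  have "?W = {h \<in> walks L. \<forall>i j. i \<le> 0 \<and> 0 < j \<longrightarrow> \<not> walk_rel h i j}"
    using walk_rel_cut_iff_nonneg[OF _ L] by (intro Collect_cong conj_cong) simp_all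
  hence "walk_rel ` ?W = ?C"
    unfolding bij_betw_imp_surj_on[OF bij_betw_walk_rel[OF L], symmetric] by auto
  moreover have "inj_on walk_rel ?W"
    using inj_on_walk_rel[OF L] by (rule inj_on_subset) auto
  ultimately have "card ?C = card ?W" using card_image[of walk_rel ?W] by (simp only:)
  thus ?thesis
    using bij_betw_same_card[OF bij_betw_wrap_cut[OF L]] card_nonneg_walks[OF L] by simp
qed

lemma sum_gcd_totient:
  fixes f :: "nat \<Rightarrow> 'a :: comm_semiring_1"
  assumes "n > 0"
  shows "(\<Sum>k\<in>{0<..n}. f (gcd k n)) = (\<Sum>d | d dvd n. of_nat (totient (n div d)) * f d)"
proof -
  have "(\<Sum>k\<in>{0<..n}. f (gcd k n)) = (\<Sum>d | d dvd n. \<Sum>k\<in>{k\<in>{0<..n}. gcd k n = d}. f (gcd k n))"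
    by (rule sum.group[symmetric]) (use assms in auto)
  also have "\<dots> = (\<Sum>d | d dvd n. \<Sum>k\<in>{k\<in>{0<..n}. gcd k n = d}. f d)"
    by (intro sum.cong) auto
  also have "\<dots> = (\<Sum>d | d dvd n. of_nat (totient (n div d)) * f d)"
    by (intro sum.cong) (simp_all only: sum_constant mem_Collect_eq card_gcd_eq_totient[OF assms])
  finally show ?thesis .
qed

theorem theorem2p2:
  fixes L :: nat
  assumes "L \<ge> 1"
  shows "real (N_Z_tri_PF L) =
    1 / real L * (catalan L +
      (\<Sum>d\<in>{d. d dvd L \<and> 1 \<le> d \<and> d < L}. real (totient (L div d)) * real ((2 * d) choose d)))"
proof -
  interpret A: group_action "rotation_group L" "noncrossing_partitions L" "partition_action L"
    by (rule group_action_rotation_group)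
  note carrier = carrier_rotation_group[OF assms] and inj = inj_on_shift_map[OF assms]
  have order: "order (rotation_group L) = L"
    unfolding order_def carrier by (simp add: card_image[OF inj])
  \<comment> \<open>Burnside's lemma, multiplied by the group order \<open>L\<close>.\<close>
  have "N_Z_tri_PF L * L =
      (\<Sum>g\<in>carrier (rotation_group L). card (invariants (noncrossing_partitions L) (partition_action L) g))"
    using A.burnside[OF _ finite_noncrossing_partitions] order unfolding N_Z_tri_PF_def carrier by simp
  also have "\<dots> = (\<Sum>k\<in>{0<..L}. card (cyclic_ncrel L (gcd k L)))"
    unfolding carrier by (simp add: sum.reindex[OF inj] card_invariants_shift_map[OF assms])
  also have "\<dots> = (\<Sum>d | d dvd L. totient (L div d) * card (cyclic_ncrel L d))"
    using sum_gcd_totient[of L "\<lambda>d. card (cyclic_ncrel L d)"] assms by simp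
  also have "{d. d dvd L} = insert L {d. d dvd L \<and> 1 \<le> d \<and> d < L}"
  proof -
    have "d = L \<or> 1 \<le> d \<and> d < L" if "d dvd L" for d
      using dvd_imp_le[OF that] dvd_pos_nat[OF _ that] assms by linarith
    moreover have "L dvd L" by simp
    ultimately show ?thesis by blast
  qed
  \<comment> \<open>The divisor \<open>L\<close> belongs to the identity alone: its coefficient is
    \<open>totient 1 = 1\<close>, and its term becomes the Catalan number.\<close>
  also have "(\<Sum>d\<in>\<dots>. totient (L div d) * card (cyclic_ncrel L d)) = card (cyclic_ncrel L L) +
      (\<Sum>d\<in>{d. d dvd L \<and> 1 \<le> d \<and> d < L}. totient (L div d) * card (cyclic_ncrel L d))"
    using assms by (subst sum.insert) auto
  also have "(\<Sum>d\<in>{d. d dvd L \<and> 1 \<le> d \<and> d < L}. totient (L div d) * card (cyclic_ncrel L d)) =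
      (\<Sum>d\<in>{d. d dvd L \<and> 1 \<le> d \<and> d < L}. totient (L div d) * ((2 * d) choose d))"
    by (intro sum.cong) (auto simp: card_cyclic_ncrel)
  finally have "real (N_Z_tri_PF L) * real L = catalan L +
      (\<Sum>d\<in>{d. d dvd L \<and> 1 \<le> d \<and> d < L}. real (totient (L div d)) * real ((2 * d) choose d))"
    unfolding card_cyclic_ncrel_self[OF assms, symmetric]
    by (metis (no_types, lifting) of_nat_add of_nat_mult of_nat_sum sum.cong)
  thus ?thesis using assms by (simp add: field_simps)
qed

end
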